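(* Let $p$ be a prime and let $\mathfrak{A}$ be an $\mathbb{F}_p$-linear additive category equipped with a biexact monoidal product $\otimes$. Let $C$, $D$ be two $p$-complexes in $\mathfrak{A}$. There is a morphism of ordinary complexes $$h_{C,D}: C_{[1]}\otimes D_{[1]}\to (C\otimes D)_{[1]}$$ with the following properties: (1) $h_{C,D}$ is natural with respect to the $p$-complexes $C,D$. (2) $h^0_{C,D}$ and $h^1_{C,D}$ are identity maps. (3) The restriction of $h^*_{C,D}$ to the graded subobject $p(C,D)^*$ of $(C_{[1]}\otimes D_{[1]})^*$ is the inclusion of $p(C,D)^*$ into $(C\otimes D)_{[1]}^*$; i.e. the square of graded objects with horizontal maps $h^*_{C,D}:(C_{[1]}\otimes D_{[1]})^*\to (C\otimes D)^*_{[1]}$ and $\mathrm{id}:p(C,D)^*\to p(C,D)^*$, and vertical maps the canonical inclusions, commutes.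
   Context: A $p$-complex in $\mathfrak{A}$ is a graded object $C^\bullet=\bigoplus_{n\in\mathbb{N}}C^n$ with a morphism $d$ of degree $1$ such that $d^p=0$. For $1\le s\le p-1$, the contraction $C_{[s]}$ is the ordinary (nonnegative cochain) complex $$C^0\xrightarrow{d^s}C^s\xrightarrow{d^{p-s}}C^p\xrightarrow{d^s}C^{p+s}\xrightarrow{d^{p-s}}C^{2p}\to\cdots,$$ i.e. $C_{[s]}^{2m}=C^{pm}$ and $C_{[s]}^{2m+1}=C^{pm+s}$. The tensor product $C\otimes D$ of two $p$-complexes is the graded object $(C\otimes D)^n=\bigoplus_{i+j=n}C^i\otimes D^j$ with $p$-differential $d_C\otimes 1+1\otimes d_D$ (without sign). The tensor product $C_{[1]}\otimes D_{[1]}$ of ordinary complexes is the usual one, with sign: $d\otimes 1+(-1)^{i}1\otimes d$ on the terms of first degree $i$. The graded object $p(C,D)^*$ is $\bigoplus_{k,\ell\ge 0}C^{kp}\otimes D^{\ell p}$ with $C^{kp}\otimes D^{\ell p}$ placed in degree $2(k+\ell)$. The object $C^{kp}\otimes D^{\ell p}$ occurs exactly once as a summand of the complex $(C\otimes D)_{[1]}$, as a summand of $(C\otimes D)^{(k+\ell)p}=(C\otimes D)_{[1]}^{2(k+\ell)}$, and exactly once in $C_{[1]}\otimes D_{[1]}$, as $C_{[1]}^{2k}\otimes D_{[1]}^{2\ell}$ in degree $2(k+\ell)$; this gives the canonical inclusions of $p(C,D)^*$ into $(C\otimes D)_{[1]}^*$ and into $(C_{[1]}\otimes D_{[1]})^*$.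 *)

theory Defs
  imports "HOL-Number_Theory.Residues"
begin

section \<open>Linear additive categories\<close>

text \<open>
  Every hom-set is a module record of \<open>HOL-Algebra\<close> over a ring of integers modulo \<open>p\<close>; the
  ring-multiplication fields \<open>mult\<close> and \<open>one\<close> of that record are never used.
\<close>

record ('o, 'm) lin_cat =
  Ob :: "'o set"
  Hom :: "'o \<Rightarrow> 'o \<Rightarrow> (int, 'm) module"
  idm :: "'o \<Rightarrow> 'm"
  Comp :: "'m \<Rightarrow> 'm \<Rightarrow> 'm" (infixr "\<cdot>\<index>" 70)

record ('o, 'm) mon_cat = "('o, 'm) lin_cat" +
  tobj :: "'o \<Rightarrow> 'o \<Rightarrow> 'o" (infixr "\<boxtimes>\<index>" 75)
  tmor :: "'m \<Rightarrow> 'm \<Rightarrow> 'm" (infixr "\<boxtimes>m\<index>" 75)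
  unit_obj :: 'o
  assoc :: "'o \<Rightarrow> 'o \<Rightarrow> 'o \<Rightarrow> 'm"
  lunit :: "'o \<Rightarrow> 'm"
  runit :: "'o \<Rightarrow> 'm"

abbreviation hom_set :: "('o, 'm, 'z) lin_cat_scheme \<Rightarrow> 'o \<Rightarrow> 'o \<Rightarrow> 'm set" where
  "hom_set A X Y \<equiv> carrier (Hom A X Y)"

locale fp_linear_category =
  fixes p :: nat and A :: "('o, 'm, 'z) lin_cat_scheme" (structure)
  assumes hom_module:
      "\<lbrakk>X \<in> Ob A; Y \<in> Ob A\<rbrakk> \<Longrightarrow> module (residue_ring (int p)) (Hom A X Y)"
    and id_in_hom: "X \<in> Ob A \<Longrightarrow> idm A X \<in> hom_set A X X"
    and comp_in_hom:
      "\<lbrakk>X \<in> Ob A; Y \<in> Ob A; Z \<in> Ob A; f \<in> hom_set A X Y; g \<in> hom_set A Y Z\<rbrakk>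
        \<Longrightarrow> g \<cdot> f \<in> hom_set A X Z"
    and comp_id_right:
      "\<lbrakk>X \<in> Ob A; Y \<in> Ob A; f \<in> hom_set A X Y\<rbrakk> \<Longrightarrow> f \<cdot> idm A X = f"
    and comp_id_left:
      "\<lbrakk>X \<in> Ob A; Y \<in> Ob A; f \<in> hom_set A X Y\<rbrakk> \<Longrightarrow> idm A Y \<cdot> f = f"
    and comp_assoc:
      "\<lbrakk>W \<in> Ob A; X \<in> Ob A; Y \<in> Ob A; Z \<in> Ob A;
        f \<in> hom_set A W X; g \<in> hom_set A X Y; h \<in> hom_set A Y Z\<rbrakk>
        \<Longrightarrow> (h \<cdot> g) \<cdot> f = h \<cdot> (g \<cdot> f)"
    and comp_add_right:
      "\<lbrakk>X \<in> Ob A; Y \<in> Ob A; Z \<in> Ob A;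
        f \<in> hom_set A X Y; f' \<in> hom_set A X Y; g \<in> hom_set A Y Z\<rbrakk>
        \<Longrightarrow> g \<cdot> (f \<oplus>\<^bsub>Hom A X Y\<^esub> f') = (g \<cdot> f) \<oplus>\<^bsub>Hom A X Z\<^esub> (g \<cdot> f')"
    and comp_add_left:
      "\<lbrakk>X \<in> Ob A; Y \<in> Ob A; Z \<in> Ob A;
        f \<in> hom_set A X Y; g \<in> hom_set A Y Z; g' \<in> hom_set A Y Z\<rbrakk>
        \<Longrightarrow> (g \<oplus>\<^bsub>Hom A Y Z\<^esub> g') \<cdot> f = (g \<cdot> f) \<oplus>\<^bsub>Hom A X Z\<^esub> (g' \<cdot> f)"
    and comp_smult_right:
      "\<lbrakk>X \<in> Ob A; Y \<in> Ob A; Z \<in> Ob A; a \<in> carrier (residue_ring (int p));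
        f \<in> hom_set A X Y; g \<in> hom_set A Y Z\<rbrakk>
        \<Longrightarrow> g \<cdot> (a \<odot>\<^bsub>Hom A X Y\<^esub> f) = a \<odot>\<^bsub>Hom A X Z\<^esub> (g \<cdot> f)"
    and comp_smult_left:
      "\<lbrakk>X \<in> Ob A; Y \<in> Ob A; Z \<in> Ob A; a \<in> carrier (residue_ring (int p));
        f \<in> hom_set A X Y; g \<in> hom_set A Y Z\<rbrakk>
        \<Longrightarrow> (a \<odot>\<^bsub>Hom A Y Z\<^esub> g) \<cdot> f = a \<odot>\<^bsub>Hom A X Z\<^esub> (g \<cdot> f)"

text \<open>
  A direct sum of the finite list \<open>Xs\<close>: an object \<open>T\<close> with injections \<open>\<iota> i\<close> and projections
  \<open>\<pi> i\<close>, \<open>i < length Xs\<close>.  A direct sum of the empty list is a zero object.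
\<close>

definition is_direct_sum ::
  "('o, 'm, 'z) lin_cat_scheme \<Rightarrow> 'o list \<Rightarrow> 'o \<Rightarrow> (nat \<Rightarrow> 'm) \<Rightarrow> (nat \<Rightarrow> 'm) \<Rightarrow> bool" where
  "is_direct_sum A Xs T \<iota> \<pi> \<longleftrightarrow>
     T \<in> Ob A \<and>
     (\<forall>i<length Xs. \<iota> i \<in> hom_set A (Xs ! i) T \<and> \<pi> i \<in> hom_set A T (Xs ! i)) \<and>
     (\<forall>i<length Xs. \<forall>j<length Xs.
        Comp A (\<pi> j) (\<iota> i) = (if i = j then idm A (Xs ! i) else \<zero>\<^bsub>Hom A (Xs ! i) (Xs ! j)\<^esub>)) \<and>
     finsum (Hom A T T) (\<lambda>i. Comp A (\<iota> i) (\<pi> i)) {..<length Xs} = idm A T"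

locale fp_linear_additive_category = fp_linear_category +
  assumes direct_sums_exist: "set Xs \<subseteq> Ob A \<Longrightarrow> \<exists>T \<iota> \<pi>. is_direct_sum A Xs T \<iota> \<pi>"

text \<open>
  Direct sums are only determined up to canonical isomorphism, so the constructions below refer to
  an arbitrary choice of them, which depends on nothing but the list of summands.
\<close>

record ('o, 'm) sum_choice =
  sobj :: "'o list \<Rightarrow> 'o"
  sinj :: "'o list \<Rightarrow> nat \<Rightarrow> 'm"
  sprj :: "'o list \<Rightarrow> nat \<Rightarrow> 'm"

definition direct_sum_choice ::
  "('o, 'm, 'z) lin_cat_scheme \<Rightarrow> ('o, 'm) sum_choice \<Rightarrow> bool" where
  "direct_sum_choice A S \<longleftrightarrow>
     (\<forall>Xs. set Xs \<subseteq> Ob A \<longrightarrow> is_direct_sum A Xs (sobj S Xs) (sinj S Xs) (sprj S Xs))"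

lemma (in fp_linear_additive_category) direct_sum_choice_exists: "\<exists>S. direct_sum_choice A S"
proof -
  have "\<forall>Xs. \<exists>s. set Xs \<subseteq> Ob A \<longrightarrow> is_direct_sum A Xs (fst s) (fst (snd s)) (snd (snd s))"
    using direct_sums_exist by fastforce
  then obtain s where "\<forall>Xs. set Xs \<subseteq> Ob A \<longrightarrow>
      is_direct_sum A Xs (fst (s Xs)) (fst (snd (s Xs))) (snd (snd (s Xs)))"
    by metis
  then have "direct_sum_choice A
      \<lparr>sobj = (\<lambda>Xs. fst (s Xs)), sinj = (\<lambda>Xs. fst (snd (s Xs))), sprj = (\<lambda>Xs. snd (snd (s Xs)))\<rparr>"
    by (simp add: direct_sum_choice_def)
  then show ?thesis by blast
qed


section \<open>Biexact monoidal products\<close>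

definition is_iso :: "('o, 'm, 'z) lin_cat_scheme \<Rightarrow> 'o \<Rightarrow> 'o \<Rightarrow> 'm \<Rightarrow> bool" where
  "is_iso A X Y f \<longleftrightarrow> f \<in> hom_set A X Y \<and>
     (\<exists>g\<in>hom_set A Y X. Comp A g f = idm A X \<and> Comp A f g = idm A Y)"

definition is_kernel :: "('o, 'm, 'z) lin_cat_scheme \<Rightarrow> 'o \<Rightarrow> 'o \<Rightarrow> 'o \<Rightarrow> 'm \<Rightarrow> 'm \<Rightarrow> bool" where
  "is_kernel A X Y Z f g \<longleftrightarrow>
     f \<in> hom_set A X Y \<and> g \<in> hom_set A Y Z \<and> Comp A g f = \<zero>\<^bsub>Hom A X Z\<^esub> \<and>
     (\<forall>W\<in>Ob A. \<forall>t\<in>hom_set A W Y. Comp A g t = \<zero>\<^bsub>Hom A W Z\<^esub> \<longrightarrow>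
        (\<exists>!u. u \<in> hom_set A W X \<and> Comp A f u = t))"

definition is_cokernel :: "('o, 'm, 'z) lin_cat_scheme \<Rightarrow> 'o \<Rightarrow> 'o \<Rightarrow> 'o \<Rightarrow> 'm \<Rightarrow> 'm \<Rightarrow> bool" where
  "is_cokernel A X Y Z f g \<longleftrightarrow>
     f \<in> hom_set A X Y \<and> g \<in> hom_set A Y Z \<and> Comp A g f = \<zero>\<^bsub>Hom A X Z\<^esub> \<and>
     (\<forall>W\<in>Ob A. \<forall>t\<in>hom_set A Y W. Comp A t f = \<zero>\<^bsub>Hom A X W\<^esub> \<longrightarrow>
        (\<exists>!u. u \<in> hom_set A Z W \<and> Comp A u g = t))"

text \<open>
  The category is not assumed to be abelian: a short exact sequence \<open>0 \<rightarrow> X \<rightarrow> Y \<rightarrow> Z \<rightarrow> 0\<close> is a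
  pair \<open>f : X \<rightarrow> Y\<close>, \<open>g : Y \<rightarrow> Z\<close> such that \<open>f\<close> is a kernel of \<open>g\<close> and \<open>g\<close> a cokernel of \<open>f\<close>.
\<close>

definition short_exact :: "('o, 'm, 'z) lin_cat_scheme \<Rightarrow> 'o \<Rightarrow> 'o \<Rightarrow> 'o \<Rightarrow> 'm \<Rightarrow> 'm \<Rightarrow> bool" where
  "short_exact A X Y Z f g \<longleftrightarrow> is_kernel A X Y Z f g \<and> is_cokernel A X Y Z f g"

locale fp_biexact_monoidal_category = fp_linear_additive_category p A
  for p :: nat and A :: "('o, 'm, 'z) mon_cat_scheme" (structure) +
  assumes tobj_closed: "\<lbrakk>X \<in> Ob A; Y \<in> Ob A\<rbrakk> \<Longrightarrow> X \<boxtimes> Y \<in> Ob A"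
    and tmor_in_hom:
      "\<lbrakk>X \<in> Ob A; X' \<in> Ob A; Y \<in> Ob A; Y' \<in> Ob A; f \<in> hom_set A X X'; g \<in> hom_set A Y Y'\<rbrakk>
        \<Longrightarrow> f \<boxtimes>m g \<in> hom_set A (X \<boxtimes> Y) (X' \<boxtimes> Y')"
    and tmor_id: "\<lbrakk>X \<in> Ob A; Y \<in> Ob A\<rbrakk> \<Longrightarrow> idm A X \<boxtimes>m idm A Y = idm A (X \<boxtimes> Y)"
    and tmor_comp:
      "\<lbrakk>X \<in> Ob A; X' \<in> Ob A; X'' \<in> Ob A; Y \<in> Ob A; Y' \<in> Ob A; Y'' \<in> Ob A;
        f \<in> hom_set A X X'; f' \<in> hom_set A X' X''; g \<in> hom_set A Y Y'; g' \<in> hom_set A Y' Y''\<rbrakk>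
        \<Longrightarrow> (f' \<cdot> f) \<boxtimes>m (g' \<cdot> g) = (f' \<boxtimes>m g') \<cdot> (f \<boxtimes>m g)"
    and tmor_add_left:
      "\<lbrakk>X \<in> Ob A; X' \<in> Ob A; Y \<in> Ob A; Y' \<in> Ob A;
        f \<in> hom_set A X X'; f' \<in> hom_set A X X'; g \<in> hom_set A Y Y'\<rbrakk>
        \<Longrightarrow> (f \<oplus>\<^bsub>Hom A X X'\<^esub> f') \<boxtimes>m g = (f \<boxtimes>m g) \<oplus>\<^bsub>Hom A (X \<boxtimes> Y) (X' \<boxtimes> Y')\<^esub> (f' \<boxtimes>m g)"
    and tmor_add_right:
      "\<lbrakk>X \<in> Ob A; X' \<in> Ob A; Y \<in> Ob A; Y' \<in> Ob A;
        f \<in> hom_set A X X'; g \<in> hom_set A Y Y'; g' \<in> hom_set A Y Y'\<rbrakk>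
        \<Longrightarrow> f \<boxtimes>m (g \<oplus>\<^bsub>Hom A Y Y'\<^esub> g') = (f \<boxtimes>m g) \<oplus>\<^bsub>Hom A (X \<boxtimes> Y) (X' \<boxtimes> Y')\<^esub> (f \<boxtimes>m g')"
    and tmor_smult_left:
      "\<lbrakk>X \<in> Ob A; X' \<in> Ob A; Y \<in> Ob A; Y' \<in> Ob A; a \<in> carrier (residue_ring (int p));
        f \<in> hom_set A X X'; g \<in> hom_set A Y Y'\<rbrakk>
        \<Longrightarrow> (a \<odot>\<^bsub>Hom A X X'\<^esub> f) \<boxtimes>m g = a \<odot>\<^bsub>Hom A (X \<boxtimes> Y) (X' \<boxtimes> Y')\<^esub> (f \<boxtimes>m g)"
    and tmor_smult_right:
      "\<lbrakk>X \<in> Ob A; X' \<in> Ob A; Y \<in> Ob A; Y' \<in> Ob A; a \<in> carrier (residue_ring (int p));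
        f \<in> hom_set A X X'; g \<in> hom_set A Y Y'\<rbrakk>
        \<Longrightarrow> f \<boxtimes>m (a \<odot>\<^bsub>Hom A Y Y'\<^esub> g) = a \<odot>\<^bsub>Hom A (X \<boxtimes> Y) (X' \<boxtimes> Y')\<^esub> (f \<boxtimes>m g)"
    and tensor_exact_right:
      "\<lbrakk>W \<in> Ob A; X \<in> Ob A; Y \<in> Ob A; Z \<in> Ob A; short_exact A X Y Z f g\<rbrakk>
        \<Longrightarrow> short_exact A (W \<boxtimes> X) (W \<boxtimes> Y) (W \<boxtimes> Z) (idm A W \<boxtimes>m f) (idm A W \<boxtimes>m g)"
    and tensor_exact_left:
      "\<lbrakk>W \<in> Ob A; X \<in> Ob A; Y \<in> Ob A; Z \<in> Ob A; short_exact A X Y Z f g\<rbrakk>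
        \<Longrightarrow> short_exact A (X \<boxtimes> W) (Y \<boxtimes> W) (Z \<boxtimes> W) (f \<boxtimes>m idm A W) (g \<boxtimes>m idm A W)"
    and unit_obj_closed: "unit_obj A \<in> Ob A"
    and assoc_iso:
      "\<lbrakk>X \<in> Ob A; Y \<in> Ob A; Z \<in> Ob A\<rbrakk>
        \<Longrightarrow> is_iso A ((X \<boxtimes> Y) \<boxtimes> Z) (X \<boxtimes> (Y \<boxtimes> Z)) (assoc A X Y Z)"
    and lunit_iso: "X \<in> Ob A \<Longrightarrow> is_iso A (unit_obj A \<boxtimes> X) X (lunit A X)"
    and runit_iso: "X \<in> Ob A \<Longrightarrow> is_iso A (X \<boxtimes> unit_obj A) X (runit A X)"
    and assoc_natural:
      "\<lbrakk>X \<in> Ob A; X' \<in> Ob A; Y \<in> Ob A; Y' \<in> Ob A; Z \<in> Ob A; Z' \<in> Ob A;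
        f \<in> hom_set A X X'; g \<in> hom_set A Y Y'; h \<in> hom_set A Z Z'\<rbrakk>
        \<Longrightarrow> assoc A X' Y' Z' \<cdot> ((f \<boxtimes>m g) \<boxtimes>m h) = (f \<boxtimes>m (g \<boxtimes>m h)) \<cdot> assoc A X Y Z"
    and lunit_natural:
      "\<lbrakk>X \<in> Ob A; Y \<in> Ob A; f \<in> hom_set A X Y\<rbrakk>
        \<Longrightarrow> lunit A Y \<cdot> (idm A (unit_obj A) \<boxtimes>m f) = f \<cdot> lunit A X"
    and runit_natural:
      "\<lbrakk>X \<in> Ob A; Y \<in> Ob A; f \<in> hom_set A X Y\<rbrakk>
        \<Longrightarrow> runit A Y \<cdot> (f \<boxtimes>m idm A (unit_obj A)) = f \<cdot> runit A X"
    and pentagon: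
      "\<lbrakk>W \<in> Ob A; X \<in> Ob A; Y \<in> Ob A; Z \<in> Ob A\<rbrakk>
        \<Longrightarrow> assoc A W X (Y \<boxtimes> Z) \<cdot> assoc A (W \<boxtimes> X) Y Z =
            (idm A W \<boxtimes>m assoc A X Y Z) \<cdot> (assoc A W (X \<boxtimes> Y) Z \<cdot> (assoc A W X Y \<boxtimes>m idm A Z))"
    and triangle:
      "\<lbrakk>X \<in> Ob A; Y \<in> Ob A\<rbrakk>
        \<Longrightarrow> (idm A X \<boxtimes>m lunit A Y) \<cdot> assoc A X (unit_obj A) Y = runit A X \<boxtimes>m idm A Y"


section \<open>Complexes and \<open>p\<close>-complexes\<close>

record ('o, 'm) cpx =
  gr :: "nat \<Rightarrow> 'o"
  dif :: "nat \<Rightarrow> 'm"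

text \<open>\<open>dpow A C n k\<close> is the iterated differential from degree \<open>n\<close> to degree \<open>n + k\<close>.\<close>

primrec dpow :: "('o, 'm, 'z) lin_cat_scheme \<Rightarrow> ('o, 'm) cpx \<Rightarrow> nat \<Rightarrow> nat \<Rightarrow> 'm" where
  "dpow A C n 0 = idm A (gr C n)"
| "dpow A C n (Suc k) = Comp A (dif C (n + k)) (dpow A C n k)"

definition graded_with_dif :: "('o, 'm, 'z) lin_cat_scheme \<Rightarrow> ('o, 'm) cpx \<Rightarrow> bool" where
  "graded_with_dif A C \<longleftrightarrow>
     (\<forall>n. gr C n \<in> Ob A \<and> dif C n \<in> hom_set A (gr C n) (gr C (Suc n)))"

definition p_complex :: "nat \<Rightarrow> ('o, 'm, 'z) lin_cat_scheme \<Rightarrow> ('o, 'm) cpx \<Rightarrow> bool" where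
  "p_complex p A C \<longleftrightarrow> graded_with_dif A C \<and>
     (\<forall>n. dpow A C n p = \<zero>\<^bsub>Hom A (gr C n) (gr C (n + p))\<^esub>)"

definition cochain_complex :: "('o, 'm, 'z) lin_cat_scheme \<Rightarrow> ('o, 'm) cpx \<Rightarrow> bool" where
  "cochain_complex A C \<longleftrightarrow> graded_with_dif A C \<and>
     (\<forall>n. Comp A (dif C (Suc n)) (dif C n) = \<zero>\<^bsub>Hom A (gr C n) (gr C (Suc (Suc n)))\<^esub>)"

definition dif_morphism ::
  "('o, 'm, 'z) lin_cat_scheme \<Rightarrow> ('o, 'm) cpx \<Rightarrow> ('o, 'm) cpx \<Rightarrow> (nat \<Rightarrow> 'm) \<Rightarrow> bool" where
  "dif_morphism A C D f \<longleftrightarrow>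
     (\<forall>n. f n \<in> hom_set A (gr C n) (gr D n) \<and>
          Comp A (f (Suc n)) (dif C n) = Comp A (dif D n) (f n))"

definition p_complex_morphism ::
  "nat \<Rightarrow> ('o, 'm, 'z) lin_cat_scheme \<Rightarrow> ('o, 'm) cpx \<Rightarrow> ('o, 'm) cpx \<Rightarrow> (nat \<Rightarrow> 'm) \<Rightarrow> bool" where
  "p_complex_morphism p A C D f \<longleftrightarrow> p_complex p A C \<and> p_complex p A D \<and> dif_morphism A C D f"

definition cochain_morphism ::
  "('o, 'm, 'z) lin_cat_scheme \<Rightarrow> ('o, 'm) cpx \<Rightarrow> ('o, 'm) cpx \<Rightarrow> (nat \<Rightarrow> 'm) \<Rightarrow> bool" where
  "cochain_morphism A C D f \<longleftrightarrow> cochain_complex A C \<and> cochain_complex A D \<and> dif_morphism A C D f"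

text \<open>The degree of \<open>C\<close> that sits in degree \<open>n\<close> of the contraction \<open>C\<^sub>[\<^sub>s\<^sub>]\<close>.\<close>

definition cdeg :: "nat \<Rightarrow> nat \<Rightarrow> nat \<Rightarrow> nat" where
  "cdeg p s n = (if even n then p * (n div 2) else p * (n div 2) + s)"

definition contraction ::
  "nat \<Rightarrow> ('o, 'm, 'z) lin_cat_scheme \<Rightarrow> nat \<Rightarrow> ('o, 'm) cpx \<Rightarrow> ('o, 'm) cpx" where
  "contraction p A s C =
     \<lparr>gr = (\<lambda>n. gr C (cdeg p s n)),
      dif = (\<lambda>n. dpow A C (cdeg p s n) (if even n then s else p - s))\<rparr>"

definition contraction_mor :: "nat \<Rightarrow> nat \<Rightarrow> (nat \<Rightarrow> 'm) \<Rightarrow> nat \<Rightarrow> 'm" where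
  "contraction_mor p s f = (\<lambda>n. f (cdeg p s n))"


section \<open>Tensor products\<close>

text \<open>The summands \<open>C i \<otimes> D (n - i)\<close>, \<open>0 \<le> i \<le> n\<close>, of the degree-\<open>n\<close> part, listed by \<open>i\<close>.\<close>

definition tensor_summands ::
  "('o, 'm, 'z) mon_cat_scheme \<Rightarrow> ('o, 'm) cpx \<Rightarrow> ('o, 'm) cpx \<Rightarrow> nat \<Rightarrow> 'o list" where
  "tensor_summands A C D n = map (\<lambda>i. tobj A (gr C i) (gr D (n - i))) [0..<Suc n]"

definition tensor_gr ::
  "('o, 'm, 'z) mon_cat_scheme \<Rightarrow> ('o, 'm) sum_choice \<Rightarrow> ('o, 'm) cpx \<Rightarrow> ('o, 'm) cpx \<Rightarrow> nat \<Rightarrow> 'o" where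
  "tensor_gr A S C D n = sobj S (tensor_summands A C D n)"

text \<open>
  The differential \<open>d \<otimes> 1 + \<epsilon>\<^sub>i 1 \<otimes> d\<close> on the terms of first degree \<open>i\<close>, where \<open>\<epsilon>\<^sub>i = -1\<close> if
  \<open>neg i\<close> holds and \<open>\<epsilon>\<^sub>i = 1\<close> otherwise.
\<close>

definition tensor_dif ::
  "(nat \<Rightarrow> bool) \<Rightarrow> ('o, 'm, 'z) mon_cat_scheme \<Rightarrow> ('o, 'm) sum_choice \<Rightarrow>
     ('o, 'm) cpx \<Rightarrow> ('o, 'm) cpx \<Rightarrow> nat \<Rightarrow> 'm" where
  "tensor_dif neg A S C D n =
     (let Xs = tensor_summands A C D n; Ys = tensor_summands A C D (Suc n);
          H = Hom A (tensor_gr A S C D n) (tensor_gr A S C D (Suc n))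
      in finsum H
        (\<lambda>i. let d1 = Comp A (sinj S Ys (Suc i))
                    (Comp A (tmor A (dif C i) (idm A (gr D (n - i)))) (sprj S Xs i));
                 d2 = Comp A (sinj S Ys i)
                    (Comp A (tmor A (idm A (gr C i)) (dif D (n - i))) (sprj S Xs i))
             in d1 \<oplus>\<^bsub>H\<^esub> (if neg i then \<ominus>\<^bsub>H\<^esub> d2 else d2))
        {..n})"

definition p_tensor ::
  "('o, 'm, 'z) mon_cat_scheme \<Rightarrow> ('o, 'm) sum_choice \<Rightarrow> ('o, 'm) cpx \<Rightarrow> ('o, 'm) cpx \<Rightarrow> ('o, 'm) cpx" where
  "p_tensor A S C D = \<lparr>gr = tensor_gr A S C D, dif = tensor_dif (\<lambda>i. False) A S C D\<rparr>"

definition cochain_tensor ::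
  "('o, 'm, 'z) mon_cat_scheme \<Rightarrow> ('o, 'm) sum_choice \<Rightarrow> ('o, 'm) cpx \<Rightarrow> ('o, 'm) cpx \<Rightarrow> ('o, 'm) cpx" where
  "cochain_tensor A S C D = \<lparr>gr = tensor_gr A S C D, dif = tensor_dif odd A S C D\<rparr>"

text \<open>The morphism \<open>f \<otimes> g : C \<otimes> D \<rightarrow> C' \<otimes> D'\<close> of graded objects.\<close>

definition tensor_mor ::
  "('o, 'm, 'z) mon_cat_scheme \<Rightarrow> ('o, 'm) sum_choice \<Rightarrow> ('o, 'm) cpx \<Rightarrow> ('o, 'm) cpx \<Rightarrow>
     ('o, 'm) cpx \<Rightarrow> ('o, 'm) cpx \<Rightarrow> (nat \<Rightarrow> 'm) \<Rightarrow> (nat \<Rightarrow> 'm) \<Rightarrow> nat \<Rightarrow> 'm" where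
  "tensor_mor A S C D C' D' f g n =
     finsum (Hom A (tensor_gr A S C D n) (tensor_gr A S C' D' n))
       (\<lambda>i. Comp A (sinj S (tensor_summands A C' D' n) i)
              (Comp A (tmor A (f i) (g (n - i))) (sprj S (tensor_summands A C D n) i)))
       {..n}"


section \<open>The graded object \<open>p(C,D)\<close> and its two inclusions\<close>

text \<open>
  Degree \<open>2 m\<close> is the sum of the \<open>C (p k) \<otimes> D (p (m - k))\<close>, \<open>0 \<le> k \<le> m\<close>, listed by \<open>k\<close>;
  odd degrees are zero (the empty sum).
\<close>

definition pCD_summands ::
  "nat \<Rightarrow> ('o, 'm, 'z) mon_cat_scheme \<Rightarrow> ('o, 'm) cpx \<Rightarrow> ('o, 'm) cpx \<Rightarrow> nat \<Rightarrow> 'o list" where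
  "pCD_summands p A C D n =
     (if even n
      then map (\<lambda>k. tobj A (gr C (p * k)) (gr D (p * (n div 2 - k)))) [0..<Suc (n div 2)]
      else [])"

definition pCD_gr ::
  "nat \<Rightarrow> ('o, 'm, 'z) mon_cat_scheme \<Rightarrow> ('o, 'm) sum_choice \<Rightarrow> ('o, 'm) cpx \<Rightarrow> ('o, 'm) cpx \<Rightarrow> nat \<Rightarrow> 'o"
  where "pCD_gr p A S C D n = sobj S (pCD_summands p A C D n)"

text \<open>
  The morphism \<open>\<Oplus>Xs \<rightarrow> \<Oplus>Ys\<close> that is the identity from the \<open>k\<close>-th summand of \<open>Xs\<close> to the
  \<open>\<phi> k\<close>-th summand of \<open>Ys\<close>; it is meaningful only when these summands agree.
\<close>

definition summand_incl ::
  "('o, 'm, 'z) lin_cat_scheme \<Rightarrow> ('o, 'm) sum_choice \<Rightarrow> 'o list \<Rightarrow> 'o list \<Rightarrow> (nat \<Rightarrow> nat) \<Rightarrow> 'm" where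
  "summand_incl A S Xs Ys \<phi> =
     finsum (Hom A (sobj S Xs) (sobj S Ys))
       (\<lambda>k. Comp A (sinj S Ys (\<phi> k)) (sprj S Xs k)) {..<length Xs}"

text \<open>
  The \<open>k\<close>-th summand of \<open>p(C,D)\<close> in degree \<open>2 m\<close> is the summand of index \<open>p k\<close> of
  \<open>C \<otimes> D\<close> in degree \<open>p m\<close> and the summand of index \<open>2 k\<close> of \<open>C\<^sub>[\<^sub>1\<^sub>] \<otimes> D\<^sub>[\<^sub>1\<^sub>]\<close> in degree \<open>2 m\<close>.
\<close>

definition pCD_incl_contraction ::
  "nat \<Rightarrow> ('o, 'm, 'z) mon_cat_scheme \<Rightarrow> ('o, 'm) sum_choice \<Rightarrow> ('o, 'm) cpx \<Rightarrow> ('o, 'm) cpx \<Rightarrow> nat \<Rightarrow> 'm"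
  where "pCD_incl_contraction p A S C D n =
     summand_incl A S (pCD_summands p A C D n) (tensor_summands A C D (cdeg p 1 n)) (\<lambda>k. p * k)"

definition pCD_incl_tensor ::
  "nat \<Rightarrow> ('o, 'm, 'z) mon_cat_scheme \<Rightarrow> ('o, 'm) sum_choice \<Rightarrow> ('o, 'm) cpx \<Rightarrow> ('o, 'm) cpx \<Rightarrow> nat \<Rightarrow> 'm"
  where "pCD_incl_tensor p A S C D n =
     summand_incl A S (pCD_summands p A C D n)
       (tensor_summands A (contraction p A 1 C) (contraction p A 1 D) n) (\<lambda>k. 2 * k)"

text \<open>
  Consistency of the encoding: the summands named in the two inclusions agree, and in degrees
  \<open>0\<close> and \<open>1\<close> the complexes \<open>C\<^sub>[\<^sub>1\<^sub>] \<otimes> D\<^sub>[\<^sub>1\<^sub>]\<close> and \<open>(C \<otimes> D)\<^sub>[\<^sub>1\<^sub>]\<close> have literally the same object,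
  so that it makes sense for a morphism between them to be an identity there.
\<close>

lemma pCD_summands_nth:
  assumes "k < length (pCD_summands p A C D n)"
  shows "tensor_summands A C D (cdeg p 1 n) ! (p * k) = pCD_summands p A C D n ! k"
    and "tensor_summands A (contraction p A 1 C) (contraction p A 1 D) n ! (2 * k) =
         pCD_summands p A C D n ! k"
proof -
  from assms have "even n" and k: "k \<le> n div 2"
    by (auto simp: pCD_summands_def split: if_splits)
  then obtain m where n: "n = 2 * m" by blast
  have km: "k \<le> m" using k n by simp
  have pk: "p * k \<le> p * m" using km by simp
  have e: "2 * m - 2 * k = 2 * (m - k)" by (simp add: diff_mult_distrib2)
  have lhs: "pCD_summands p A C D n ! k = tobj A (gr C (p * k)) (gr D (p * (m - k)))"
    using km by (simp add: pCD_summands_def n del: upt_Suc)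
  show "tensor_summands A C D (cdeg p 1 n) ! (p * k) = pCD_summands p A C D n ! k"
    unfolding lhs using pk
    by (simp add: tensor_summands_def cdeg_def n diff_mult_distrib2 le_imp_less_Suc del: upt_Suc)
  show "tensor_summands A (contraction p A 1 C) (contraction p A 1 D) n ! (2 * k) =
         pCD_summands p A C D n ! k"
    unfolding lhs using km
    by (simp add: tensor_summands_def contraction_def cdeg_def n e del: upt_Suc)
qed

lemma contraction_tensor_gr_low:
  assumes "n \<le> 1"
  shows "gr (cochain_tensor A S (contraction p A 1 C) (contraction p A 1 D)) n =
         gr (contraction p A 1 (p_tensor A S C D)) n"
proof -
  from assms consider "n = 0" | "n = 1" by linarith
  then show ?thesis
    by cases (simp_all add: cochain_tensor_def p_tensor_def contraction_def tensor_gr_def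
        tensor_summands_def cdeg_def)
qed

end

theory Submission
  imports Defs
begin

text \<open>
  Write \<open>x = d \<otimes> 1\<close> and \<open>y = 1 \<otimes> d\<close> for the commuting partial differentials of \<open>C \<otimes> D\<close>.  The
  total differential is \<open>x + y\<close>, and since \<open>(p - 1 choose a)\<close> is congruent to \<open>(-1)\<^sup>a\<close> modulo \<open>p\<close>
  (\<open>prime_choose_minus_1_cong\<close>), its power of exponent \<open>p - 1\<close> is the sum of the terms
  \<open>(-1)\<^sup>a x\<^sup>a y\<^sup>b\<close> with \<open>a + b = p - 1\<close>.

  The summand with indices \<open>(i, j)\<close> of \<open>C\<^sub>[\<^sub>1\<^sub>] \<otimes> D\<^sub>[\<^sub>1\<^sub>]\<close> is also a summand of \<open>C \<otimes> D\<close>.  There it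
  already sits in the degree that \<open>h\<close> must reach, except when \<open>i\<close> and \<open>j\<close> are both odd: then it
  sits \<open>p - 2\<close> degrees too low (\<open>cdeg_gap\<close>).  So let \<open>h\<close> be the inclusion when \<open>i\<close> or \<open>j\<close> is even,
  and the inclusion followed by a homogeneous polynomial \<open>q(x, y)\<close> of degree \<open>p - 2\<close> when both are
  odd.  As the differential of \<open>C\<^sub>[\<^sub>1\<^sub>] \<otimes> D\<^sub>[\<^sub>1\<^sub>]\<close> alternates between first and \<open>(p - 1)\<close>-st powers of
  \<open>x\<close> and of \<open>y\<close>, and carries a minus sign on the second term when \<open>i\<close> is odd, compatibility with
  the differentials says

    \<^item> \<open>x + y = x + y\<close> for \<open>i\<close>, \<open>j\<close> even;
    \<^item> \<open>x\<^sup>p\<^sup>-\<^sup>1 - q y = (x + y)\<^sup>p\<^sup>-\<^sup>1\<close> for \<open>i\<close> odd, \<open>j\<close> even;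
    \<^item> \<open>q x + y\<^sup>p\<^sup>-\<^sup>1 = (x + y)\<^sup>p\<^sup>-\<^sup>1\<close> for \<open>i\<close> even, \<open>j\<close> odd;
    \<^item> \<open>x\<^sup>p\<^sup>-\<^sup>1 - y\<^sup>p\<^sup>-\<^sup>1 = (x + y) q\<close> for \<open>i\<close>, \<open>j\<close> odd.

  The second identity determines \<open>q\<close> as minus the sum of the \<open>(-1)\<^sup>a x\<^sup>a y\<^sup>b\<close> with \<open>a + b = p - 2\<close>,
  and this \<open>q\<close> satisfies the last two as well; the signs match because \<open>(-1)\<^sup>p\<^sup>-\<^sup>1 = 1\<close> modulo \<open>p\<close>
  (\<open>comparison_column_chain\<close>).  Naturality holds because a morphism \<open>f \<otimes> g\<close> commutes with \<open>x\<close> and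
  \<open>y\<close>, hence with every polynomial in them (\<open>tensor_mor_tpoly\<close>).  Properties (2) and (3) only
  concern summands with \<open>i\<close> or \<open>j\<close> even, where \<open>h\<close> is the inclusion.

  A morphism out of a direct sum is determined by its restrictions to the summands (\<open>dsum_ext\<close>,
  \<open>tensor_ext\<close>), and on a summand of \<open>C \<otimes> D\<close> every morphism that occurs is a polynomial in \<open>x\<close> and
  \<open>y\<close> with integer coefficients, encoded by \<open>tpoly\<close>.  The identities above thereby become
  congruences between coefficients.
\<close>

section \<open>Binomial coefficients modulo a prime\<close>

text \<open>
  Pascal's rule makes consecutive coefficients of row \<open>p - 1\<close> add up to an inner coefficient of row
  \<open>p\<close>, which \<open>p\<close> divides.
\<close>

lemma prime_choose_minus_1_cong:
  fixes p :: nat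
  assumes p: "prime p" and a: "a \<le> p - 1"
  shows "[int (p - 1 choose a) = (- 1) ^ a] (mod int p)"
  using a
proof (induction a)
  case (Suc a)
  have "p choose Suc a = (p - 1 choose a) + (p - 1 choose Suc a)"
    using prime_gt_0_nat[OF p] by (metis Suc_diff_1 binomial_Suc_Suc)
  moreover have "[int (p choose Suc a) = 0] (mod int p)"
    using dvd_choose_prime[OF _ _ _ p, of "Suc a"] Suc.prems by (simp add: cong_0_iff)
  ultimately have "[int (p - 1 choose Suc a) = - int (p - 1 choose a)] (mod int p)"
    by (simp add: cong_iff_dvd_diff add.commute)
  also have "[- int (p - 1 choose a) = - ((- 1) ^ a)] (mod int p)"
    using Suc by (simp add: cong_minus_minus_iff)
  finally show ?case by simp
qed simp

text \<open>
  Taking \<open>a = p - 1\<close> above covers \<open>p = 2\<close> and odd \<open>p\<close> at once.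
\<close>

lemma minus_one_power_cong:
  fixes p :: nat
  assumes "prime p"
  shows "[(- 1) ^ (p - 1) = 1] (mod int p)"
  using prime_choose_minus_1_cong[OF assms order_refl] by (simp add: cong_sym)


section \<open>Calculus in a linear category over a prime field\<close>

locale prime_linear_category = fp_linear_category p A
  for p :: nat and A :: "('o, 'm, 'z) lin_cat_scheme" (structure) +
  assumes prime_p: "prime p"
begin

text \<open>
  Membership of the two objects is bundled with membership in the hom-set, so that the rules below
  chain without separate conditions on objects.
\<close>

definition arr :: "'o \<Rightarrow> 'o \<Rightarrow> 'm \<Rightarrow> bool" where
  "arr X Y f \<longleftrightarrow> X \<in> Ob A \<and> Y \<in> Ob A \<and> f \<in> hom_set A X Y"

text \<open>
  The scalar is reduced modulo \<open>p\<close> because the modules are over the residues \<open>0, \<dots>, p - 1\<close>; this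
  turns every hom-set into a module over the integers.
\<close>

definition scal :: "'o \<Rightarrow> 'o \<Rightarrow> int \<Rightarrow> 'm \<Rightarrow> 'm" where
  "scal X Y k f = (k mod int p) \<odot>\<^bsub>Hom A X Y\<^esub> f"

lemma p_gt_1: "int p > 1"
  using prime_gt_1_nat[OF prime_p] by simp

lemma residue_closed: "k mod int p \<in> carrier (residue_ring (int p))"
  using p_gt_1 by (simp add: residue_ring_def)

lemma arr_ob: "arr X Y f \<Longrightarrow> X \<in> Ob A" "arr X Y f \<Longrightarrow> Y \<in> Ob A"
  and arr_hom: "arr X Y f \<Longrightarrow> f \<in> hom_set A X Y"
  by (auto simp: arr_def)

lemma id_arr: "X \<in> Ob A \<Longrightarrow> arr X X (idm A X)"
  by (simp add: arr_def id_in_hom)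

lemma comp_arr: "\<lbrakk>arr X Y f; arr Y Z g\<rbrakk> \<Longrightarrow> arr X Z (g \<cdot> f)"
  unfolding arr_def using comp_in_hom by blast

lemma hom_abelian: "\<lbrakk>X \<in> Ob A; Y \<in> Ob A\<rbrakk> \<Longrightarrow> abelian_group (Hom A X Y)"
  using hom_module by (simp add: module_def)

lemma hom_monoid: "\<lbrakk>X \<in> Ob A; Y \<in> Ob A\<rbrakk> \<Longrightarrow> abelian_monoid (Hom A X Y)"
  using hom_abelian by (simp add: abelian_group_def)

lemma zero_arr: "\<lbrakk>X \<in> Ob A; Y \<in> Ob A\<rbrakk> \<Longrightarrow> arr X Y \<zero>\<^bsub>Hom A X Y\<^esub>"
  using abelian_monoid.zero_closed[OF hom_monoid] by (simp add: arr_def)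

lemma add_arr: "\<lbrakk>arr X Y f; arr X Y g\<rbrakk> \<Longrightarrow> arr X Y (f \<oplus>\<^bsub>Hom A X Y\<^esub> g)"
  using abelian_monoid.a_closed[OF hom_monoid] unfolding arr_def by blast

lemma scal_arr: "arr X Y f \<Longrightarrow> arr X Y (scal X Y k f)"
  unfolding arr_def scal_def using module.smult_closed[OF hom_module residue_closed] by blast

lemma sum_arr:
  assumes "X \<in> Ob A" "Y \<in> Ob A" "\<And>i. i \<in> I \<Longrightarrow> arr X Y (\<phi> i)"
  shows "arr X Y (finsum (Hom A X Y) \<phi> I)"
  unfolding arr_def using assms
  by (intro conjI abelian_monoid.finsum_closed[OF hom_monoid]) (auto simp: arr_def)

lemma sum_cong:
  assumes "X \<in> Ob A" "Y \<in> Ob A" "\<And>i. i \<in> I \<Longrightarrow> arr X Y (\<psi> i)" "\<And>i. i \<in> I \<Longrightarrow> \<phi> i = \<psi> i"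
  shows "finsum (Hom A X Y) \<phi> I = finsum (Hom A X Y) \<psi> I"
  using assms by (intro abelian_monoid.finsum_cong' hom_monoid) (auto simp: arr_def)

lemma sum_add:
  assumes "X \<in> Ob A" "Y \<in> Ob A" "\<And>i. i \<in> I \<Longrightarrow> arr X Y (\<phi> i)" "\<And>i. i \<in> I \<Longrightarrow> arr X Y (\<psi> i)"
  shows "finsum (Hom A X Y) (\<lambda>i. \<phi> i \<oplus>\<^bsub>Hom A X Y\<^esub> \<psi> i) I =
    finsum (Hom A X Y) \<phi> I \<oplus>\<^bsub>Hom A X Y\<^esub> finsum (Hom A X Y) \<psi> I"
  using assms by (intro abelian_monoid.finsum_addf hom_monoid) (auto simp: arr_def)

lemma add_zero:
  assumes "arr X Y f"
  shows "f \<oplus>\<^bsub>Hom A X Y\<^esub> \<zero>\<^bsub>Hom A X Y\<^esub> = f" "\<zero>\<^bsub>Hom A X Y\<^esub> \<oplus>\<^bsub>Hom A X Y\<^esub> f = f"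
  using abelian_monoid.r_zero[OF hom_monoid] abelian_monoid.l_zero[OF hom_monoid] assms
  unfolding arr_def by blast+

lemma scal_add:
  assumes "arr X Y f"
  shows "scal X Y (k + l) f = scal X Y k f \<oplus>\<^bsub>Hom A X Y\<^esub> scal X Y l f"
proof -
  interpret H: module "residue_ring (int p)" "Hom A X Y"
    using assms by (intro hom_module arr_ob)
  have "(k + l) mod int p = k mod int p \<oplus>\<^bsub>residue_ring (int p)\<^esub> l mod int p"
    by (simp add: residue_ring_def mod_add_eq)
  then show ?thesis
    unfolding scal_def
    using H.smult_l_distr[OF residue_closed residue_closed arr_hom[OF assms]] by simp
qed

lemma scal_mult:
  assumes "arr X Y f"
  shows "scal X Y (k * l) f = scal X Y k (scal X Y l f)"
proof -
  interpret H: module "residue_ring (int p)" "Hom A X Y"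
    using assms by (intro hom_module arr_ob)
  have "(k * l) mod int p = (k mod int p) \<otimes>\<^bsub>residue_ring (int p)\<^esub> (l mod int p)"
    by (simp add: residue_ring_def mod_mult_eq)
  then show ?thesis
    unfolding scal_def
    using H.smult_assoc1[OF residue_closed residue_closed arr_hom[OF assms]] by simp
qed

lemma scal_one:
  assumes "arr X Y f"
  shows "scal X Y 1 f = f"
proof -
  interpret H: module "residue_ring (int p)" "Hom A X Y"
    using assms by (intro hom_module arr_ob)
  have "1 mod int p = \<one>\<^bsub>residue_ring (int p)\<^esub>"
    using p_gt_1 by (simp add: residue_ring_def)
  then show ?thesis
    unfolding scal_def using H.smult_one[OF arr_hom[OF assms]] by simp
qed

lemma scal_zero:
  assumes "arr X Y f"
  shows "scal X Y 0 f = \<zero>\<^bsub>Hom A X Y\<^esub>"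
proof -
  interpret H: module "residue_ring (int p)" "Hom A X Y"
    using assms by (intro hom_module arr_ob)
  have "0 mod int p = \<zero>\<^bsub>residue_ring (int p)\<^esub>"
    by (simp add: residue_ring_def)
  then show ?thesis
    unfolding scal_def using H.smult_l_null[OF arr_hom[OF assms]] by simp
qed

lemma scal_zero_right:
  assumes "X \<in> Ob A" "Y \<in> Ob A"
  shows "scal X Y k \<zero>\<^bsub>Hom A X Y\<^esub> = \<zero>\<^bsub>Hom A X Y\<^esub>"
  unfolding scal_def by (rule module.smult_r_null[OF hom_module residue_closed]) (fact assms)+

lemma scal_cong: "[k = l] (mod int p) \<Longrightarrow> scal X Y k f = scal X Y l f"
  by (simp add: scal_def cong_def)

lemma scal_add_right:
  assumes "arr X Y f" "arr X Y g"
  shows "scal X Y k (f \<oplus>\<^bsub>Hom A X Y\<^esub> g) = scal X Y k f \<oplus>\<^bsub>Hom A X Y\<^esub> scal X Y k g"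
  using module.smult_r_distr[OF hom_module residue_closed] assms unfolding arr_def scal_def by blast

lemma scal_minus_one:
  assumes "arr X Y f"
  shows "\<ominus>\<^bsub>Hom A X Y\<^esub> f = scal X Y (-1) f"
proof -
  interpret H: abelian_group "Hom A X Y"
    using assms by (intro hom_abelian arr_ob)
  have "scal X Y (-1) f \<oplus>\<^bsub>Hom A X Y\<^esub> f = \<zero>\<^bsub>Hom A X Y\<^esub>"
    using scal_add[OF assms, of "-1" 1] by (simp add: scal_one[OF assms] scal_zero[OF assms])
  then show ?thesis
    using H.minus_equality arr_hom[OF assms] arr_hom[OF scal_arr[OF assms]] by blast
qed

lemma scal_sum:
  assumes "X \<in> Ob A" "Y \<in> Ob A" "finite I" "\<And>i. i \<in> I \<Longrightarrow> arr X Y (\<phi> i)"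
  shows "scal X Y k (finsum (Hom A X Y) \<phi> I) = finsum (Hom A X Y) (\<lambda>i. scal X Y k (\<phi> i)) I"
proof -
  interpret H: abelian_group "Hom A X Y" using assms by (intro hom_abelian)
  show ?thesis
    using assms(3,4)
  proof (induction I rule: finite_induct)
    case empty
    show ?case using assms by (simp add: scal_zero_right)
  next
    case (insert i I)
    have h: "\<And>j. j \<in> insert i I \<Longrightarrow> \<phi> j \<in> hom_set A X Y"
      "\<And>j. j \<in> insert i I \<Longrightarrow> scal X Y k (\<phi> j) \<in> hom_set A X Y"
      by (rule arr_hom insert.prems scal_arr; assumption?)+
    have "arr X Y (finsum (Hom A X Y) \<phi> I)" using insert.prems assms by (intro sum_arr) auto
    with insert h show ?case
      by (subst (1 2) H.finsum_insert) (auto simp: scal_add_right)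
  qed
qed

lemma comp_scal_right:
  assumes "arr X Y f" "arr Y Z g"
  shows "g \<cdot> scal X Y k f = scal X Z k (g \<cdot> f)"
  using comp_smult_right[OF _ _ _ residue_closed] assms unfolding arr_def scal_def by blast

lemma comp_scal_left:
  assumes "arr X Y f" "arr Y Z g"
  shows "scal Y Z k g \<cdot> f = scal X Z k (g \<cdot> f)"
  using comp_smult_left[OF _ _ _ residue_closed] assms unfolding arr_def scal_def by blast

lemma arr_comp_add_right:
  assumes "arr X Y f" "arr X Y f'" "arr Y Z g"
  shows "g \<cdot> (f \<oplus>\<^bsub>Hom A X Y\<^esub> f') = (g \<cdot> f) \<oplus>\<^bsub>Hom A X Z\<^esub> (g \<cdot> f')"
  using comp_add_right assms unfolding arr_def by blast

lemma arr_comp_add_left: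
  assumes "arr X Y f" "arr Y Z g" "arr Y Z g'"
  shows "(g \<oplus>\<^bsub>Hom A Y Z\<^esub> g') \<cdot> f = (g \<cdot> f) \<oplus>\<^bsub>Hom A X Z\<^esub> (g' \<cdot> f)"
  using comp_add_left assms unfolding arr_def by blast

lemma arr_comp_assoc:
  assumes "arr W X f" "arr X Y g" "arr Y Z h"
  shows "(h \<cdot> g) \<cdot> f = h \<cdot> (g \<cdot> f)"
  using comp_assoc assms unfolding arr_def by blast

lemma arr_comp_id:
  assumes "arr X Y f"
  shows "f \<cdot> idm A X = f" "idm A Y \<cdot> f = f"
  using assms comp_id_right comp_id_left by (auto simp: arr_def)

lemma comp_zero:
  shows "\<lbrakk>X \<in> Ob A; arr Y Z g\<rbrakk> \<Longrightarrow> g \<cdot> \<zero>\<^bsub>Hom A X Y\<^esub> = \<zero>\<^bsub>Hom A X Z\<^esub>"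
    and "\<lbrakk>Z \<in> Ob A; arr X Y f\<rbrakk> \<Longrightarrow> \<zero>\<^bsub>Hom A Y Z\<^esub> \<cdot> f = \<zero>\<^bsub>Hom A X Z\<^esub>"
proof -
  assume h: "X \<in> Ob A" "arr Y Z g"
  note z = zero_arr[OF h(1) arr_ob(1)[OF h(2)]]
  show "g \<cdot> \<zero>\<^bsub>Hom A X Y\<^esub> = \<zero>\<^bsub>Hom A X Z\<^esub>"
    using comp_scal_right[OF z h(2), of 0] scal_zero[OF z] scal_zero[OF comp_arr[OF z h(2)]] by simp
next
  assume h: "Z \<in> Ob A" "arr X Y f"
  note z = zero_arr[OF arr_ob(2)[OF h(2)] h(1)]
  show "\<zero>\<^bsub>Hom A Y Z\<^esub> \<cdot> f = \<zero>\<^bsub>Hom A X Z\<^esub>"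
    using comp_scal_left[OF h(2) z, of 0] scal_zero[OF z] scal_zero[OF comp_arr[OF h(2) z]] by simp
qed

lemma comp_sum_right:
  assumes "X \<in> Ob A" "arr Y Z g" "finite I" "\<And>i. i \<in> I \<Longrightarrow> arr X Y (\<phi> i)"
  shows "g \<cdot> finsum (Hom A X Y) \<phi> I = finsum (Hom A X Z) (\<lambda>i. g \<cdot> \<phi> i) I"
proof -
  note ob = assms(1) arr_ob[OF assms(2)]
  interpret H: abelian_group "Hom A X Y" using ob by (intro hom_abelian)
  interpret K: abelian_group "Hom A X Z" using ob by (intro hom_abelian)
  show ?thesis
    using assms(3,4)
  proof (induction I rule: finite_induct)
    case empty
    show ?case using assms by (simp add: comp_zero)
  next
    case (insert i I)
    have h: "\<And>j. j \<in> insert i I \<Longrightarrow> \<phi> j \<in> hom_set A X Y"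
      "\<And>j. j \<in> insert i I \<Longrightarrow> g \<cdot> \<phi> j \<in> hom_set A X Z"
      by (rule arr_hom insert.prems comp_arr[OF _ assms(2)]; assumption?)+
    have s: "arr X Y (finsum (Hom A X Y) \<phi> I)" using insert.prems ob by (intro sum_arr) auto
    have "g \<cdot> finsum (Hom A X Y) \<phi> (insert i I) =
        g \<cdot> (\<phi> i \<oplus>\<^bsub>Hom A X Y\<^esub> finsum (Hom A X Y) \<phi> I)"
      using insert h by (subst H.finsum_insert) auto
    also have "\<dots> = g \<cdot> \<phi> i \<oplus>\<^bsub>Hom A X Z\<^esub> g \<cdot> finsum (Hom A X Y) \<phi> I"
      using insert.prems s assms(2) by (intro arr_comp_add_right) auto
    also have "\<dots> = finsum (Hom A X Z) (\<lambda>i. g \<cdot> \<phi> i) (insert i I)"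
      using insert h by (subst K.finsum_insert) auto
    finally show ?case .
  qed
qed

lemma comp_sum_left:
  assumes "arr X Y f" "Z \<in> Ob A" "finite I" "\<And>i. i \<in> I \<Longrightarrow> arr Y Z (\<phi> i)"
  shows "finsum (Hom A Y Z) \<phi> I \<cdot> f = finsum (Hom A X Z) (\<lambda>i. \<phi> i \<cdot> f) I"
proof -
  note ob = assms(2) arr_ob[OF assms(1)]
  interpret H: abelian_group "Hom A Y Z" using ob by (intro hom_abelian)
  interpret K: abelian_group "Hom A X Z" using ob by (intro hom_abelian)
  show ?thesis
    using assms(3,4)
  proof (induction I rule: finite_induct)
    case empty
    show ?case using assms by (simp add: comp_zero)
  next
    case (insert i I)
    have h: "\<And>j. j \<in> insert i I \<Longrightarrow> \<phi> j \<in> hom_set A Y Z"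
      "\<And>j. j \<in> insert i I \<Longrightarrow> \<phi> j \<cdot> f \<in> hom_set A X Z"
      by (rule arr_hom insert.prems comp_arr[OF assms(1)]; assumption?)+
    have s: "arr Y Z (finsum (Hom A Y Z) \<phi> I)" using insert.prems ob by (intro sum_arr) auto
    have "finsum (Hom A Y Z) \<phi> (insert i I) \<cdot> f =
        (\<phi> i \<oplus>\<^bsub>Hom A Y Z\<^esub> finsum (Hom A Y Z) \<phi> I) \<cdot> f"
      using insert h by (subst H.finsum_insert) auto
    also have "\<dots> = \<phi> i \<cdot> f \<oplus>\<^bsub>Hom A X Z\<^esub> finsum (Hom A Y Z) \<phi> I \<cdot> f"
      using insert.prems s assms(1) by (intro arr_comp_add_left) auto
    also have "\<dots> = finsum (Hom A X Z) (\<lambda>i. \<phi> i \<cdot> f) (insert i I)"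
      using insert h by (subst K.finsum_insert) auto
    finally show ?case .
  qed
qed

context
  fixes Xs T \<iota> \<pi>
  assumes dsum: "is_direct_sum A Xs T \<iota> \<pi>" and Xs: "set Xs \<subseteq> Ob A"
begin

lemma dsum_arr:
  "i < length Xs \<Longrightarrow> arr (Xs ! i) T (\<iota> i)" "i < length Xs \<Longrightarrow> arr T (Xs ! i) (\<pi> i)"
  using dsum Xs nth_mem unfolding is_direct_sum_def arr_def by blast+

lemma dsum_ob: "T \<in> Ob A"
  using dsum unfolding is_direct_sum_def by blast

text \<open>
  The identity of a direct sum is the sum of the \<open>\<iota> i \<cdot> \<pi> i\<close>, so every morphism out of it is
  recovered from its composites with the injections.  With no summands this says that a zero
  object has only one morphism to any object.
\<close>

lemma dsum_ext:
  assumes f: "arr T U f" and g: "arr T U g"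
    and eq: "\<And>i. i < length Xs \<Longrightarrow> f \<cdot> \<iota> i = g \<cdot> \<iota> i"
  shows "f = g"
proof -
  have expand: "h = finsum (Hom A T U) (\<lambda>i. (h \<cdot> \<iota> i) \<cdot> \<pi> i) {..<length Xs}" if h: "arr T U h" for h
  proof -
    have "h = h \<cdot> finsum (Hom A T T) (\<lambda>i. \<iota> i \<cdot> \<pi> i) {..<length Xs}"
      using dsum arr_comp_id[OF h] unfolding is_direct_sum_def by simp
    also have "\<dots> = finsum (Hom A T U) (\<lambda>i. h \<cdot> (\<iota> i \<cdot> \<pi> i)) {..<length Xs}"
      using dsum_ob h dsum_arr by (intro comp_sum_right) (auto intro: comp_arr)
    also have "\<dots> = finsum (Hom A T U) (\<lambda>i. (h \<cdot> \<iota> i) \<cdot> \<pi> i) {..<length Xs}"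
      using dsum_ob arr_ob[OF h]
      by (intro sum_cong) (auto intro: comp_arr arr_comp_assoc[symmetric] dsum_arr h)
    finally show ?thesis .
  qed
  have "finsum (Hom A T U) (\<lambda>i. (f \<cdot> \<iota> i) \<cdot> \<pi> i) {..<length Xs} =
      finsum (Hom A T U) (\<lambda>i. (g \<cdot> \<iota> i) \<cdot> \<pi> i) {..<length Xs}"
    using arr_ob[OF f] by (intro sum_cong) (auto simp: eq intro: comp_arr dsum_arr g)
  then show ?thesis using expand[OF f] expand[OF g] by simp
qed

lemma copair:
  assumes U: "U \<in> Ob A" and \<phi>: "\<And>i. i < length Xs \<Longrightarrow> arr (Xs ! i) U (\<phi> i)"
  shows "arr T U (finsum (Hom A T U) (\<lambda>i. \<phi> i \<cdot> \<pi> i) {..<length Xs})"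
    and "k < length Xs \<Longrightarrow> finsum (Hom A T U) (\<lambda>i. \<phi> i \<cdot> \<pi> i) {..<length Xs} \<cdot> \<iota> k = \<phi> k"
proof -
  show "arr T U (finsum (Hom A T U) (\<lambda>i. \<phi> i \<cdot> \<pi> i) {..<length Xs})"
    using U dsum_ob by (intro sum_arr) (auto intro: comp_arr dsum_arr \<phi>)
  assume k: "k < length Xs"
  then have Xk: "Xs ! k \<in> Ob A" using Xs by auto
  have "finsum (Hom A T U) (\<lambda>i. \<phi> i \<cdot> \<pi> i) {..<length Xs} \<cdot> \<iota> k =
      finsum (Hom A (Xs ! k) U) (\<lambda>i. (\<phi> i \<cdot> \<pi> i) \<cdot> \<iota> k) {..<length Xs}"
    using U k by (intro comp_sum_left) (auto intro: comp_arr dsum_arr \<phi>)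
  also have "\<dots> = finsum (Hom A (Xs ! k) U) (\<lambda>i. if k = i then \<phi> k else \<zero>\<^bsub>Hom A (Xs ! k) U\<^esub>) {..<length Xs}"
  proof (rule sum_cong[OF Xk U])
    fix i assume "i \<in> {..<length Xs}"
    then have i: "i < length Xs" by simp
    show "arr (Xs ! k) U (if k = i then \<phi> k else \<zero>\<^bsub>Hom A (Xs ! k) U\<^esub>)"
      using \<phi>[OF k] zero_arr[OF Xk U] by auto
    have "(\<phi> i \<cdot> \<pi> i) \<cdot> \<iota> k = \<phi> i \<cdot> (\<pi> i \<cdot> \<iota> k)"
      by (rule arr_comp_assoc[OF dsum_arr(1)[OF k] dsum_arr(2)[OF i] \<phi>[OF i]])
    also have "\<pi> i \<cdot> \<iota> k = (if k = i then idm A (Xs ! k) else \<zero>\<^bsub>Hom A (Xs ! k) (Xs ! i)\<^esub>)"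
      using dsum i k unfolding is_direct_sum_def by simp
    finally show "(\<phi> i \<cdot> \<pi> i) \<cdot> \<iota> k = (if k = i then \<phi> k else \<zero>\<^bsub>Hom A (Xs ! k) U\<^esub>)"
      using arr_comp_id(1)[OF \<phi>[OF i]] comp_zero(1)[OF Xk \<phi>[OF i]] by (cases "k = i") simp_all
  qed
  also have "\<dots> = \<phi> k"
    using k arr_hom[OF \<phi>[OF k]]
    by (intro abelian_monoid.finsum_singleton[OF hom_monoid[OF Xk U], where f = "\<lambda>i. \<phi> k"]) auto
  finally show "finsum (Hom A T U) (\<lambda>i. \<phi> i \<cdot> \<pi> i) {..<length Xs} \<cdot> \<iota> k = \<phi> k" .
qed

end

end


section \<open>Tensor products of graded objects, summand by summand\<close>

locale tensor_setting = fp_biexact_monoidal_category p A + prime_linear_category p A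
  for p :: nat and A :: "('o, 'm, 'z) mon_cat_scheme" (structure) +
  fixes S :: "('o, 'm) sum_choice"
  assumes choice: "direct_sum_choice A S"
begin

abbreviation "tgr C D n \<equiv> tensor_gr A S C D n"
abbreviation "summ C D i j \<equiv> gr C i \<boxtimes> gr D j"
abbreviation "pdif C D n \<equiv> dif (p_tensor A S C D) n"

lemma tens_arr: "\<lbrakk>arr X X' f; arr Y Y' g\<rbrakk> \<Longrightarrow> arr (X \<boxtimes> Y) (X' \<boxtimes> Y') (f \<boxtimes>m g)"
  unfolding arr_def using tobj_closed tmor_in_hom by blast

lemma tens_comp:
  assumes "arr X X' f" "arr X' X'' f'" "arr Y Y' g" "arr Y' Y'' g'"
  shows "(f' \<boxtimes>m g') \<cdot> (f \<boxtimes>m g) = (f' \<cdot> f) \<boxtimes>m (g' \<cdot> g)"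
  using assms tmor_comp[of X X' X'' Y Y' Y'' f f' g g'] unfolding arr_def by simp

lemma tens_scal:
  assumes "arr X X' f" "arr Y Y' g"
  shows "scal X X' k f \<boxtimes>m g = scal (X \<boxtimes> Y) (X' \<boxtimes> Y') k (f \<boxtimes>m g)"
    and "f \<boxtimes>m scal Y Y' k g = scal (X \<boxtimes> Y) (X' \<boxtimes> Y') k (f \<boxtimes>m g)"
  using assms tmor_smult_left[OF _ _ _ _ residue_closed] tmor_smult_right[OF _ _ _ _ residue_closed]
  unfolding arr_def scal_def by blast+

lemma tens_zero:
  shows "\<lbrakk>X \<in> Ob A; X' \<in> Ob A; arr Y Y' g\<rbrakk>
      \<Longrightarrow> \<zero>\<^bsub>Hom A X X'\<^esub> \<boxtimes>m g = \<zero>\<^bsub>Hom A (X \<boxtimes> Y) (X' \<boxtimes> Y')\<^esub>"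
    and "\<lbrakk>Y \<in> Ob A; Y' \<in> Ob A; arr X X' f\<rbrakk>
      \<Longrightarrow> f \<boxtimes>m \<zero>\<^bsub>Hom A Y Y'\<^esub> = \<zero>\<^bsub>Hom A (X \<boxtimes> Y) (X' \<boxtimes> Y')\<^esub>"
proof -
  assume "X \<in> Ob A" "X' \<in> Ob A" and g: "arr Y Y' g"
  then have z: "arr X X' \<zero>\<^bsub>Hom A X X'\<^esub>" by (simp add: zero_arr)
  show "\<zero>\<^bsub>Hom A X X'\<^esub> \<boxtimes>m g = \<zero>\<^bsub>Hom A (X \<boxtimes> Y) (X' \<boxtimes> Y')\<^esub>"
    using tens_scal(1)[OF z g, of 0] scal_zero[OF z] scal_zero[OF tens_arr[OF z g]] by simp
next
  assume "Y \<in> Ob A" "Y' \<in> Ob A" and f: "arr X X' f"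
  then have z: "arr Y Y' \<zero>\<^bsub>Hom A Y Y'\<^esub>" by (simp add: zero_arr)
  show "f \<boxtimes>m \<zero>\<^bsub>Hom A Y Y'\<^esub> = \<zero>\<^bsub>Hom A (X \<boxtimes> Y) (X' \<boxtimes> Y')\<^esub>"
    using tens_scal(2)[OF f z, of 0] scal_zero[OF z] scal_zero[OF tens_arr[OF f z]] by simp
qed

lemma gr_ob: "graded_with_dif A C \<Longrightarrow> gr C n \<in> Ob A"
  by (simp add: graded_with_dif_def)

lemma dif_arr: "graded_with_dif A C \<Longrightarrow> arr (gr C n) (gr C (Suc n)) (dif C n)"
  by (simp add: graded_with_dif_def arr_def)

lemma dpow_arr: "graded_with_dif A C \<Longrightarrow> arr (gr C n) (gr C (n + k)) (dpow A C n k)"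
  by (induction k) (auto intro: id_arr gr_ob comp_arr dif_arr)

lemma dpow_add:
  assumes "graded_with_dif A C"
  shows "dpow A C n (k + l) = dpow A C (n + k) l \<cdot> dpow A C n k"
proof (induction l)
  case 0
  show ?case using arr_comp_id(2)[OF dpow_arr[OF assms]] by simp
next
  case (Suc l)
  have "(dif C (n + k + l) \<cdot> dpow A C (n + k) l) \<cdot> dpow A C n k =
      dif C (n + k + l) \<cdot> (dpow A C (n + k) l \<cdot> dpow A C n k)"
    by (rule arr_comp_assoc[OF dpow_arr[OF assms] dpow_arr[OF assms] dif_arr[OF assms]])
  with Suc show ?case by (simp add: add.assoc)
qed

lemma p_complex_graded: "p_complex q A C \<Longrightarrow> graded_with_dif A C"
  by (simp add: p_complex_def)

lemma dpow_vanish: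
  assumes "p_complex q A C" "q \<le> k"
  shows "dpow A C n k = \<zero>\<^bsub>Hom A (gr C n) (gr C (n + k))\<^esub>"
proof -
  note g = p_complex_graded[OF assms(1)]
  obtain l where k: "k = q + l" using assms(2) le_Suc_ex by blast
  have "dpow A C n k = dpow A C (n + q) l \<cdot> \<zero>\<^bsub>Hom A (gr C n) (gr C (n + q))\<^esub>"
    using assms(1) by (simp add: k dpow_add[OF g] p_complex_def)
  also have "\<dots> = \<zero>\<^bsub>Hom A (gr C n) (gr C (n + k))\<^esub>"
    using comp_zero(1)[OF gr_ob[OF g] dpow_arr[OF g, of "n + q" l], of n] by (simp add: k add.assoc)
  finally show ?thesis .
qed

lemma contraction_graded:
  assumes "graded_with_dif A C" "s \<le> p"
  shows "graded_with_dif A (contraction p A s C)"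
proof -
  have "arr (gr C (cdeg p s n)) (gr C (cdeg p s (Suc n)))
      (dpow A C (cdeg p s n) (if even n then s else p - s))" for n
    using dpow_arr[OF assms(1), of "cdeg p s n" "if even n then s else p - s"] assms(2)
    by (auto simp: cdeg_def add.commute elim!: oddE)
  then show ?thesis by (simp add: graded_with_dif_def contraction_def arr_def)
qed

text \<open>
  Two consecutive differentials of the contraction are powers of \<open>d\<close> whose exponents \<open>s\<close> and
  \<open>p - s\<close> add up to \<open>p\<close>.
\<close>

lemma contraction_cochain:
  assumes "p_complex p A C" "s \<le> p"
  shows "cochain_complex A (contraction p A s C)"
proof -
  note g = p_complex_graded[OF assms(1)]
  have "dpow A C (cdeg p s (Suc n)) (if even (Suc n) then s else p - s) \<cdot>
      dpow A C (cdeg p s n) (if even n then s else p - s) =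
      \<zero>\<^bsub>Hom A (gr C (cdeg p s n)) (gr C (cdeg p s (Suc (Suc n))))\<^esub>" (is "?l = ?r") for n
  proof -
    let ?k = "if even n then s else p - s" and ?l = "if even n then p - s else s"
    have "cdeg p s (Suc n) = cdeg p s n + ?k" "cdeg p s (Suc (Suc n)) = cdeg p s n + p" "?k + ?l = p"
      using assms(2) by (auto simp: cdeg_def elim!: oddE)
    then show ?thesis
      using dpow_add[OF g, of "cdeg p s n" ?k ?l] assms(1) by (auto simp: p_complex_def split: if_splits)
  qed
  then show ?thesis
    using contraction_graded[OF g assms(2)]
    by (simp add: cochain_complex_def contraction_def del: even_Suc)
qed

lemma summands_length [simp]: "length (tensor_summands A C D n) = Suc n"
  by (simp add: tensor_summands_def)

lemma summands_nth: "i \<le> n \<Longrightarrow> tensor_summands A C D n ! i = gr C i \<boxtimes> gr D (n - i)"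
  by (simp add: tensor_summands_def del: upt_Suc)

text \<open>
  Indexing the injections of \<open>C \<otimes> D\<close> by the two degrees, instead of the total degree and a
  position, lets the differential act by raising one index.
\<close>

definition tinj :: "('o, 'm) cpx \<Rightarrow> ('o, 'm) cpx \<Rightarrow> nat \<Rightarrow> nat \<Rightarrow> 'm" where
  "tinj C D i j = sinj S (tensor_summands A C D (i + j)) i"

text \<open>
  The monomial \<open>x\<^sup>a y\<^sup>b\<close> in the partial differentials, restricted to the summand \<open>(i, j)\<close>.
\<close>

definition tpow :: "('o, 'm) cpx \<Rightarrow> ('o, 'm) cpx \<Rightarrow> nat \<Rightarrow> nat \<Rightarrow> nat \<Rightarrow> nat \<Rightarrow> 'm" where
  "tpow C D i j a b = tinj C D (i + a) (j + b) \<cdot> (dpow A C i a \<boxtimes>m dpow A D j b)"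

text \<open>
  The homogeneous polynomial of degree \<open>n\<close> with coefficient \<open>c a\<close> at \<open>x\<^sup>a y\<^sup>n\<^sup>-\<^sup>a\<close>, restricted to the
  summand \<open>(i, j)\<close>.
\<close>

definition tpoly :: "('o, 'm) cpx \<Rightarrow> ('o, 'm) cpx \<Rightarrow> nat \<Rightarrow> nat \<Rightarrow> nat \<Rightarrow> (nat \<Rightarrow> int) \<Rightarrow> 'm" where
  "tpoly C D i j n c =
     finsum (Hom A (gr C i \<boxtimes> gr D j) (tensor_gr A S C D (i + j + n)))
       (\<lambda>a. scal (gr C i \<boxtimes> gr D j) (tensor_gr A S C D (i + j + n)) (c a) (tpow C D i j a (n - a))) {..n}"

text \<open>
  The morphism out of \<open>(C \<otimes> D)\<^sup>n\<close> with prescribed restrictions to the summands.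
\<close>

definition cotuple :: "('o, 'm) cpx \<Rightarrow> ('o, 'm) cpx \<Rightarrow> nat \<Rightarrow> 'o \<Rightarrow> (nat \<Rightarrow> nat \<Rightarrow> 'm) \<Rightarrow> 'm" where
  "cotuple C D n U \<phi> =
     finsum (Hom A (tensor_gr A S C D n) U)
       (\<lambda>i. \<phi> i (n - i) \<cdot> sprj S (tensor_summands A C D n) i) {..n}"

context
  fixes C D :: "('o, 'm) cpx"
  assumes C: "graded_with_dif A C" and D: "graded_with_dif A D"
begin

lemma summands_ob: "set (tensor_summands A C D n) \<subseteq> Ob A"
  by (auto simp: tensor_summands_def intro!: tobj_closed gr_ob C D)

lemma tensor_dsum:
  "is_direct_sum A (tensor_summands A C D n) (tensor_gr A S C D n)
     (sinj S (tensor_summands A C D n)) (sprj S (tensor_summands A C D n))"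
  using choice summands_ob by (simp add: direct_sum_choice_def tensor_gr_def)

lemma tensor_gr_ob: "tensor_gr A S C D n \<in> Ob A"
  by (rule dsum_ob[OF tensor_dsum summands_ob])

lemma summand_ob: "gr C i \<boxtimes> gr D j \<in> Ob A"
  by (intro tobj_closed gr_ob C D)

lemma tinj_arr: "arr (gr C i \<boxtimes> gr D j) (tensor_gr A S C D (i + j)) (tinj C D i j)"
  using dsum_arr(1)[OF tensor_dsum summands_ob, of i "i + j"] by (simp add: summands_nth tinj_def)

lemma tprj_arr: "i \<le> n \<Longrightarrow>
  arr (tensor_gr A S C D n) (gr C i \<boxtimes> gr D (n - i)) (sprj S (tensor_summands A C D n) i)"
  using dsum_arr(2)[OF tensor_dsum summands_ob, of i n] by (simp add: summands_nth)

lemma tensor_ext: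
  assumes "arr (tensor_gr A S C D n) U f" "arr (tensor_gr A S C D n) U g"
    and "\<And>i j. i + j = n \<Longrightarrow> f \<cdot> tinj C D i j = g \<cdot> tinj C D i j"
  shows "f = g"
proof (rule dsum_ext[OF tensor_dsum summands_ob assms(1,2)])
  fix i assume "i < length (tensor_summands A C D n)"
  then show "f \<cdot> sinj S (tensor_summands A C D n) i = g \<cdot> sinj S (tensor_summands A C D n) i"
    using assms(3)[of i "n - i"] by (simp add: tinj_def)
qed

lemma cotuple:
  assumes U: "U \<in> Ob A" and \<phi>: "\<And>i j. i + j = n \<Longrightarrow> arr (gr C i \<boxtimes> gr D j) U (\<phi> i j)"
  shows cotuple_arr: "arr (tensor_gr A S C D n) U (cotuple C D n U \<phi>)"
    and cotuple_tinj: "i + j = n \<Longrightarrow> cotuple C D n U \<phi> \<cdot> tinj C D i j = \<phi> i j"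
proof -
  have \<phi>': "arr (tensor_summands A C D n ! i) U (\<phi> i (n - i))" if "i < length (tensor_summands A C D n)" for i
    using that \<phi>[of i "n - i"] by (simp add: summands_nth)
  have eq: "{..<length (tensor_summands A C D n)} = {..n}" by auto
  note * = copair[OF tensor_dsum summands_ob, of U n "\<lambda>i. \<phi> i (n - i)", OF U \<phi>', unfolded eq]
  show "arr (tensor_gr A S C D n) U (cotuple C D n U \<phi>)"
    using *(1) by (simp add: cotuple_def)
  show "cotuple C D n U \<phi> \<cdot> tinj C D i j = \<phi> i j" if "i + j = n"
    using *(2)[of i] that by (auto simp: cotuple_def tinj_def)
qed

text \<open>
  Both kinds of tensor differential are covered: \<open>neg\<close> selects the signs, and the sign is turned
  into the scalar \<open>-1\<close> or \<open>1\<close>.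
\<close>

lemma tensor_dif_cotuple:
  "tensor_dif neg A S C D n = cotuple C D n (tensor_gr A S C D (Suc n))
     (\<lambda>i j. (tinj C D (Suc i) j \<cdot> (dif C i \<boxtimes>m idm A (gr D j)))
       \<oplus>\<^bsub>Hom A (gr C i \<boxtimes> gr D j) (tensor_gr A S C D (Suc n))\<^esub>
       scal (gr C i \<boxtimes> gr D j) (tensor_gr A S C D (Suc n)) (if neg i then - 1 else 1)
         (tinj C D i (Suc j) \<cdot> (idm A (gr C i) \<boxtimes>m dif D j)))"
  unfolding tensor_dif_def cotuple_def Let_def
proof (rule sum_cong[OF tensor_gr_ob tensor_gr_ob], goal_cases)
  case (1 i)
  then have i: "i \<le> n" by simp
  have t: "arr (gr C i \<boxtimes> gr D (n - i)) (tensor_gr A S C D (Suc n))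
      (tinj C D (Suc i) (n - i) \<cdot> (dif C i \<boxtimes>m idm A (gr D (n - i))))"
    "arr (gr C i \<boxtimes> gr D (n - i)) (tensor_gr A S C D (Suc n))
      (tinj C D i (Suc (n - i)) \<cdot> (idm A (gr C i) \<boxtimes>m dif D (n - i)))"
    using comp_arr[OF tens_arr[OF dif_arr[OF C] id_arr[OF gr_ob[OF D]]] tinj_arr, of i "n - i"]
     comp_arr[OF tens_arr[OF id_arr[OF gr_ob[OF C]] dif_arr[OF D]] tinj_arr, of i "n - i"] i by simp_all
  show ?case
    by (rule comp_arr[OF tprj_arr[OF i]]) (intro add_arr scal_arr t)
next
  case (2 i)
  then have i: "i \<le> n" by simp
  note dC = tens_arr[OF dif_arr[OF C, of i] id_arr[OF gr_ob[OF D, of "n - i"]]]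
    and dD = tens_arr[OF id_arr[OF gr_ob[OF C, of i]] dif_arr[OF D, of "n - i"]]
  have J: "arr (gr C (Suc i) \<boxtimes> gr D (n - i)) (tensor_gr A S C D (Suc n)) (tinj C D (Suc i) (n - i))"
    "arr (gr C i \<boxtimes> gr D (Suc (n - i))) (tensor_gr A S C D (Suc n)) (tinj C D i (Suc (n - i)))"
    using tinj_arr[of "Suc i" "n - i"] tinj_arr[of i "Suc (n - i)"] i by simp_all
  have s: "sinj S (tensor_summands A C D (Suc n)) (Suc i) = tinj C D (Suc i) (n - i)"
    "sinj S (tensor_summands A C D (Suc n)) i = tinj C D i (Suc (n - i))"
    using i by (simp_all add: tinj_def)
  note t = comp_arr[OF dC J(1)] comp_arr[OF dD J(2)]
  note q = tprj_arr[OF i]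
  show ?case
    unfolding s arr_comp_assoc[OF q dC J(1), symmetric] arr_comp_assoc[OF q dD J(2), symmetric]
    by (cases "neg i")
      (simp_all add: arr_comp_add_left[OF q t(1) scal_arr[OF t(2)]] comp_scal_left[OF q t(2)]
        scal_minus_one[OF comp_arr[OF q t(2)]] scal_one[OF comp_arr[OF q t(2)]] scal_one[OF t(2)]
        arr_comp_add_left[OF q t])
qed

lemma tensor_dif_terms:
  "i + j = n \<Longrightarrow> arr (gr C i \<boxtimes> gr D j) (tensor_gr A S C D (Suc n))
    (tinj C D (Suc i) j \<cdot> (dif C i \<boxtimes>m idm A (gr D j)))"
  "i + j = n \<Longrightarrow> arr (gr C i \<boxtimes> gr D j) (tensor_gr A S C D (Suc n))
    (tinj C D i (Suc j) \<cdot> (idm A (gr C i) \<boxtimes>m dif D j))"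
  using comp_arr[OF tens_arr[OF dif_arr[OF C] id_arr[OF gr_ob[OF D]]] tinj_arr, of i j]
    comp_arr[OF tens_arr[OF id_arr[OF gr_ob[OF C]] dif_arr[OF D]] tinj_arr, of i j] by auto

lemma tensor_dif_arr:
  "arr (tensor_gr A S C D n) (tensor_gr A S C D (Suc n)) (tensor_dif neg A S C D n)"
  unfolding tensor_dif_cotuple
  by (rule cotuple_arr[OF tensor_gr_ob]) (auto intro!: add_arr scal_arr tensor_dif_terms)

lemma tensor_dif_tinj:
  "tensor_dif neg A S C D (i + j) \<cdot> tinj C D i j =
     (tinj C D (Suc i) j \<cdot> (dif C i \<boxtimes>m idm A (gr D j)))
       \<oplus>\<^bsub>Hom A (gr C i \<boxtimes> gr D j) (tensor_gr A S C D (Suc (i + j)))\<^esub>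
     scal (gr C i \<boxtimes> gr D j) (tensor_gr A S C D (Suc (i + j))) (if neg i then - 1 else 1)
       (tinj C D i (Suc j) \<cdot> (idm A (gr C i) \<boxtimes>m dif D j))"
  unfolding tensor_dif_cotuple
  by (rule cotuple_tinj[OF tensor_gr_ob]) (auto intro!: add_arr scal_arr tensor_dif_terms)

lemma p_tensor_graded: "graded_with_dif A (p_tensor A S C D)"
  and cochain_tensor_graded: "graded_with_dif A (cochain_tensor A S C D)"
  using tensor_dif_arr by (auto simp: graded_with_dif_def p_tensor_def cochain_tensor_def arr_def)

end


section \<open>Polynomials in the two partial differentials\<close>

context
  fixes C D :: "('o, 'm) cpx"
  assumes C: "graded_with_dif A C" and D: "graded_with_dif A D"
begin

lemma tpow_arr:
  assumes "i + j + (a + b) = N"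
  shows "arr (summ C D i j) (tgr C D N) (tpow C D i j a b)"
proof -
  have "i + a + (j + b) = N" using assms by simp
  then show ?thesis
    using comp_arr[OF tens_arr[OF dpow_arr[OF C, of i a] dpow_arr[OF D, of j b]] tinj_arr[OF C D]]
    unfolding tpow_def by simp
qed

text \<open>
  Monomials multiply by adding exponents, since \<open>x\<close> and \<open>y\<close> act on different factors.
\<close>

lemma tpow_precomp:
  "tpow C D (i + a') (j + b') a b \<cdot> (dpow A C i a' \<boxtimes>m dpow A D j b') = tpow C D i j (a' + a) (b' + b)"
proof -
  note dC = dpow_arr[OF C] and dD = dpow_arr[OF D]
  have "tpow C D (i + a') (j + b') a b \<cdot> (dpow A C i a' \<boxtimes>m dpow A D j b') =
      tinj C D (i + a' + a) (j + b' + b) \<cdot>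
      ((dpow A C (i + a') a \<boxtimes>m dpow A D (j + b') b) \<cdot> (dpow A C i a' \<boxtimes>m dpow A D j b'))"
    unfolding tpow_def
    by (rule arr_comp_assoc[OF tens_arr[OF dC dD] tens_arr[OF dC dD] tinj_arr[OF C D]])
  also have "\<dots> = tpow C D i j (a' + a) (b' + b)"
    unfolding tens_comp[OF dC dC dD dD]
    by (simp add: tpow_def add.assoc dpow_add[OF C, symmetric] dpow_add[OF D, symmetric])
  finally show ?thesis .
qed

lemma tpow_zero_zero: "tpow C D i j 0 0 = tinj C D i j"
  using arr_comp_id(1)[OF tinj_arr[OF C D]] by (simp add: tpow_def tmor_id gr_ob[OF C] gr_ob[OF D])

text \<open>
  The exponent \<open>q\<close> is kept free: besides \<open>q = p\<close>, the case \<open>q = 2\<close> is that of ordinary complexes.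
\<close>

lemma tpow_vanish:
  assumes "p_complex q A C" "p_complex q A D" "q \<le> a \<or> q \<le> b" "i + j + (a + b) = N"
  shows "tpow C D i j a b = \<zero>\<^bsub>Hom A (summ C D i j) (tgr C D N)\<^esub>"
proof -
  note dC = dpow_arr[OF C] and dD = dpow_arr[OF D]
  have "dpow A C i a \<boxtimes>m dpow A D j b = \<zero>\<^bsub>Hom A (summ C D i j) (summ C D (i + a) (j + b))\<^esub>"
    using assms(3)
  proof
    assume "q \<le> a"
    with dpow_vanish[OF assms(1)] tens_zero(1)[OF gr_ob[OF C] gr_ob[OF C] dD] show ?thesis by simp
  next
    assume "q \<le> b"
    with dpow_vanish[OF assms(2)] tens_zero(2)[OF gr_ob[OF D] gr_ob[OF D] dC] show ?thesis by simp
  qed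
  moreover have "i + a + (j + b) = N" using assms(4) by simp
  ultimately show ?thesis
    using comp_zero(1)[OF summand_ob[OF C D, of i j] tinj_arr[OF C D, of "i + a" "j + b"]] by (simp add: tpow_def)
qed

lemma tensor_dif_tpow:
  assumes "i + j + (a + b) = N"
  shows "tensor_dif neg A S C D N \<cdot> tpow C D i j a b = tpow C D i j (Suc a) b
    \<oplus>\<^bsub>Hom A (summ C D i j) (tgr C D (Suc N))\<^esub>
    scal (summ C D i j) (tgr C D (Suc N)) (if neg (i + a) then - 1 else 1) (tpow C D i j a (Suc b))"
proof -
  note dC = dpow_arr[OF C] and dD = dpow_arr[OF D]
  have N: "N = (i + a) + (j + b)" using assms by simp
  let ?d = "dpow A C i a \<boxtimes>m dpow A D j b" and ?\<epsilon> = "if neg (i + a) then - 1 else (1 :: int)"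
  note d = tens_arr[OF dC[of i a] dD[of j b]]
  note t = tensor_dif_terms[OF C D N[symmetric]]
  have x: "(tinj C D (Suc (i + a)) (j + b) \<cdot> (dif C (i + a) \<boxtimes>m idm A (gr D (j + b)))) \<cdot> ?d =
      tpow C D i j (Suc a) b"
    using tpow_precomp[of i a j b 1 0]
    by (simp add: tpow_def arr_comp_id(1)[OF dif_arr[OF C]])
  have y: "(tinj C D (i + a) (Suc (j + b)) \<cdot> (idm A (gr C (i + a)) \<boxtimes>m dif D (j + b))) \<cdot> ?d =
      tpow C D i j a (Suc b)"
    using tpow_precomp[of i a j b 0 1]
    by (simp add: tpow_def arr_comp_id(1)[OF dif_arr[OF D]])
  have "tensor_dif neg A S C D N \<cdot> tpow C D i j a b =
      (tensor_dif neg A S C D N \<cdot> tinj C D (i + a) (j + b)) \<cdot> ?d"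
    unfolding tpow_def N by (rule arr_comp_assoc[OF d tinj_arr[OF C D] tensor_dif_arr[OF C D], symmetric])
  also have "tensor_dif neg A S C D N \<cdot> tinj C D (i + a) (j + b) =
      (tinj C D (Suc (i + a)) (j + b) \<cdot> (dif C (i + a) \<boxtimes>m idm A (gr D (j + b))))
       \<oplus>\<^bsub>Hom A (summ C D (i + a) (j + b)) (tgr C D (Suc N))\<^esub>
       scal (summ C D (i + a) (j + b)) (tgr C D (Suc N)) ?\<epsilon>
       (tinj C D (i + a) (Suc (j + b)) \<cdot> (idm A (gr C (i + a)) \<boxtimes>m dif D (j + b)))"
    using tensor_dif_tinj[OF C D, of neg "i + a" "j + b"] unfolding N by simp
  finally show ?thesis
    unfolding arr_comp_add_left[OF d t(1) scal_arr[OF t(2)]] comp_scal_left[OF d t(2)] x y .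
qed

lemma pdif_tpow:
  assumes "i + j + (a + b) = N"
  shows "pdif C D N \<cdot> tpow C D i j a b = tpow C D i j (Suc a) b
    \<oplus>\<^bsub>Hom A (summ C D i j) (tgr C D (Suc N))\<^esub> tpow C D i j a (Suc b)"
  using tensor_dif_tpow[OF assms, of "\<lambda>_. False"] scal_one[OF tpow_arr[of i j a "Suc b" "Suc N"]] assms
  by (simp add: p_tensor_def)

lemma tpoly_term_arr:
  "a \<le> n \<Longrightarrow> arr (summ C D i j) (tgr C D (i + j + n)) (tpow C D i j a (n - a))"
  by (rule tpow_arr) simp

lemma tpoly_arr: "i + j + n = N \<Longrightarrow> arr (summ C D i j) (tgr C D N) (tpoly C D i j n c)"
  unfolding tpoly_def by (auto intro!: sum_arr tensor_gr_ob[OF C D] summand_ob[OF C D] scal_arr tpoly_term_arr)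

lemma tpoly_cong:
  assumes "\<And>a. a \<le> n \<Longrightarrow> [c a = c' a] (mod int p)"
  shows "tpoly C D i j n c = tpoly C D i j n c'"
  unfolding tpoly_def
  by (rule sum_cong[OF summand_ob[OF C D] tensor_gr_ob[OF C D]]) (auto intro!: scal_arr tpoly_term_arr scal_cong assms)

lemma tpoly_add:
  assumes "i + j + n = N"
  shows "tpoly C D i j n c \<oplus>\<^bsub>Hom A (summ C D i j) (tgr C D N)\<^esub> tpoly C D i j n c' =
    tpoly C D i j n (\<lambda>a. c a + c' a)"
  unfolding tpoly_def assms[symmetric]
  by (subst sum_add[OF summand_ob[OF C D] tensor_gr_ob[OF C D], symmetric])
    (auto intro!: sum_cong summand_ob[OF C D] tensor_gr_ob[OF C D] scal_arr tpoly_term_arr scal_add[symmetric])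

lemma tpoly_scal:
  assumes "i + j + n = N"
  shows "scal (summ C D i j) (tgr C D N) k (tpoly C D i j n c) = tpoly C D i j n (\<lambda>a. k * c a)"
  unfolding tpoly_def assms[symmetric]
  by (subst scal_sum[OF summand_ob[OF C D] tensor_gr_ob[OF C D]])
    (auto intro!: sum_cong summand_ob[OF C D] tensor_gr_ob[OF C D] scal_arr tpoly_term_arr scal_mult[symmetric])

lemma tpoly_single:
  assumes "k \<le> n"
  shows "tpoly C D i j n (\<lambda>a. if a = k then 1 else 0) = tpow C D i j k (n - k)"
proof -
  have "tpoly C D i j n (\<lambda>a. if a = k then 1 else 0) =
      finsum (Hom A (summ C D i j) (tgr C D (i + j + n)))
        (\<lambda>a. if k = a then tpow C D i j k (n - k) else \<zero>\<^bsub>Hom A (summ C D i j) (tgr C D (i + j + n))\<^esub>) {..n}"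
    unfolding tpoly_def
    by (rule sum_cong[OF summand_ob[OF C D] tensor_gr_ob[OF C D]])
      (auto intro!: zero_arr summand_ob[OF C D] tensor_gr_ob[OF C D] scal_one scal_zero tpoly_term_arr assms)
  also have "\<dots> = tpow C D i j k (n - k)"
    using assms arr_hom[OF tpoly_term_arr[OF assms]]
    by (intro abelian_monoid.finsum_singleton[OF hom_monoid[OF summand_ob[OF C D] tensor_gr_ob[OF C D]],
        where f = "\<lambda>_. tpow C D i j k (n - k)"]) auto
  finally show ?thesis .
qed

text \<open>
  Multiplication by \<open>x\<close> shifts the coefficients, and multiplication by \<open>y\<close> keeps them and puts zero
  at the new leading power of \<open>x\<close> (\<open>tpoly_top\<close>).  These two reindexings describe composition with the
  partial differentials and with the total differential alike.
\<close>

lemma tpoly_shift: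
  assumes "Suc (i + j + n) = N"
  shows "finsum (Hom A (summ C D i j) (tgr C D N))
      (\<lambda>a. scal (summ C D i j) (tgr C D N) (c a) (tpow C D i j (Suc a) (n - a))) {..n} =
    tpoly C D i j (Suc n) (\<lambda>a. if a = 0 then 0 else c (a - 1))"
proof -
  interpret H: abelian_group "Hom A (summ C D i j) (tgr C D N)"
    by (rule hom_abelian[OF summand_ob[OF C D] tensor_gr_ob[OF C D]])
  let ?f = "\<lambda>a. scal (summ C D i j) (tgr C D N) (if a = 0 then 0 else c (a - 1)) (tpow C D i j a (Suc n - a))"
  have f: "arr (summ C D i j) (tgr C D N) (?f a)" if "a \<le> Suc n" for a
    using that assms by (intro scal_arr tpow_arr) simp
  have "tpoly C D i j (Suc n) (\<lambda>a. if a = 0 then 0 else c (a - 1)) =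
      finsum (Hom A (summ C D i j) (tgr C D N)) ?f {..Suc n}"
    using assms by (simp add: tpoly_def)
  also have "\<dots> = finsum (Hom A (summ C D i j) (tgr C D N)) (\<lambda>a. ?f (Suc a)) {..n}
      \<oplus>\<^bsub>Hom A (summ C D i j) (tgr C D N)\<^esub> ?f 0"
    by (rule H.finsum_Suc2) (use f in \<open>auto simp: arr_def\<close>)
  also have "?f 0 = \<zero>\<^bsub>Hom A (summ C D i j) (tgr C D N)\<^esub>"
    using scal_zero[OF tpow_arr[of i j 0 "Suc n"]] assms by simp
  also have "finsum (Hom A (summ C D i j) (tgr C D N)) (\<lambda>a. ?f (Suc a)) {..n}
      \<oplus>\<^bsub>Hom A (summ C D i j) (tgr C D N)\<^esub> \<zero>\<^bsub>Hom A (summ C D i j) (tgr C D N)\<^esub> =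
      finsum (Hom A (summ C D i j) (tgr C D N)) (\<lambda>a. ?f (Suc a)) {..n}"
    by (rule add_zero(1), rule sum_arr[OF summand_ob[OF C D] tensor_gr_ob[OF C D]]) (rule f, simp)
  finally show ?thesis by simp
qed

lemma tpoly_top:
  assumes "Suc (i + j + n) = N"
  shows "finsum (Hom A (summ C D i j) (tgr C D N))
      (\<lambda>a. scal (summ C D i j) (tgr C D N) (c a) (tpow C D i j a (Suc (n - a)))) {..n} =
    tpoly C D i j (Suc n) (\<lambda>a. if a \<le> n then c a else 0)"
proof -
  interpret H: abelian_group "Hom A (summ C D i j) (tgr C D N)"
    by (rule hom_abelian[OF summand_ob[OF C D] tensor_gr_ob[OF C D]])
  let ?f = "\<lambda>a. scal (summ C D i j) (tgr C D N) (if a \<le> n then c a else 0) (tpow C D i j a (Suc n - a))"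
  have f: "arr (summ C D i j) (tgr C D N) (?f a)" if "a \<le> Suc n" for a
    using that assms by (intro scal_arr tpow_arr) simp
  have "tpoly C D i j (Suc n) (\<lambda>a. if a \<le> n then c a else 0) =
      finsum (Hom A (summ C D i j) (tgr C D N)) ?f {..Suc n}"
    using assms by (simp add: tpoly_def)
  also have "\<dots> = ?f (Suc n) \<oplus>\<^bsub>Hom A (summ C D i j) (tgr C D N)\<^esub>
      finsum (Hom A (summ C D i j) (tgr C D N)) ?f {..n}"
    by (rule H.finsum_Suc) (use f in \<open>auto simp: arr_def\<close>)
  also have "?f (Suc n) = \<zero>\<^bsub>Hom A (summ C D i j) (tgr C D N)\<^esub>"
    using scal_zero[OF tpow_arr[of i j "Suc n" 0]] assms by simp
  also have "\<zero>\<^bsub>Hom A (summ C D i j) (tgr C D N)\<^esub> \<oplus>\<^bsub>Hom A (summ C D i j) (tgr C D N)\<^esub>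
      finsum (Hom A (summ C D i j) (tgr C D N)) ?f {..n} =
      finsum (Hom A (summ C D i j) (tgr C D N)) ?f {..n}"
    by (rule add_zero(2), rule sum_arr[OF summand_ob[OF C D] tensor_gr_ob[OF C D]]) (rule f, simp)
  also have "\<dots> = finsum (Hom A (summ C D i j) (tgr C D N))
      (\<lambda>a. scal (summ C D i j) (tgr C D N) (c a) (tpow C D i j a (Suc (n - a)))) {..n}"
    using assms by (intro sum_cong[OF summand_ob[OF C D] tensor_gr_ob[OF C D]]) (auto simp: Suc_diff_le intro!: scal_arr tpow_arr)
  finally show ?thesis by simp
qed

lemma pdif_tpoly:
  assumes N: "i + j + n = N"
  shows "pdif C D N \<cdot> tpoly C D i j n c =
    tpoly C D i j (Suc n) (\<lambda>a. (if a = 0 then 0 else c (a - 1)) + (if a \<le> n then c a else 0))"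
proof -
  let ?X = "summ C D i j" and ?Y = "tgr C D N" and ?Z = "tgr C D (Suc N)"
  have d: "arr ?Y ?Z (pdif C D N)"
    using dif_arr[OF p_tensor_graded[OF C D]] by (simp add: p_tensor_def)
  have t: "arr ?X ?Y (tpow C D i j a (n - a))" if "a \<le> n" for a
    using that N by (intro tpow_arr) simp
  have t1: "arr ?X ?Z (tpow C D i j (Suc a) (n - a))" "arr ?X ?Z (tpow C D i j a (Suc (n - a)))"
    if "a \<le> n" for a
    using that N by (auto intro!: tpow_arr)
  have "pdif C D N \<cdot> tpoly C D i j n c =
      finsum (Hom A ?X ?Z) (\<lambda>a. pdif C D N \<cdot> scal ?X ?Y (c a) (tpow C D i j a (n - a))) {..n}"
    unfolding tpoly_def N using t by (intro comp_sum_right[OF summand_ob[OF C D] d]) (auto intro: scal_arr)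
  also have "\<dots> = finsum (Hom A ?X ?Z) (\<lambda>a. scal ?X ?Z (c a) (tpow C D i j (Suc a) (n - a))
      \<oplus>\<^bsub>Hom A ?X ?Z\<^esub> scal ?X ?Z (c a) (tpow C D i j a (Suc (n - a)))) {..n}"
  proof (rule sum_cong[OF summand_ob[OF C D] tensor_gr_ob[OF C D]], goal_cases)
    case (1 a)
    with t1 show ?case by (auto intro!: add_arr scal_arr)
  next
    case (2 a)
    then have a: "a \<le> n" by simp
    show ?case
      using pdif_tpow[of i j a "n - a" N] a N
      by (simp add: comp_scal_right[OF t[OF a] d] scal_add_right[OF t1(1)[OF a] t1(2)[OF a]])
  qed
  also have "\<dots> = finsum (Hom A ?X ?Z) (\<lambda>a. scal ?X ?Z (c a) (tpow C D i j (Suc a) (n - a))) {..n}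
      \<oplus>\<^bsub>Hom A ?X ?Z\<^esub> finsum (Hom A ?X ?Z) (\<lambda>a. scal ?X ?Z (c a) (tpow C D i j a (Suc (n - a)))) {..n}"
    using t1 by (intro sum_add[OF summand_ob[OF C D] tensor_gr_ob[OF C D]]) (auto intro: scal_arr)
  finally show ?thesis
    using N by (simp add: tpoly_shift tpoly_top tpoly_add)
qed

lemma tpoly_precomp_left:
  "tpoly C D (Suc i) j n c \<cdot> (dif C i \<boxtimes>m idm A (gr D j)) =
    tpoly C D i j (Suc n) (\<lambda>a. if a = 0 then 0 else c (a - 1))"
proof -
  let ?N = "Suc (i + j + n)"
  let ?X = "summ C D i j" and ?Y = "summ C D (Suc i) j" and ?Z = "tgr C D ?N"
  have d: "arr ?X ?Y (dif C i \<boxtimes>m idm A (gr D j))"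
    by (intro tens_arr dif_arr C D id_arr gr_ob)
  have t: "arr ?Y ?Z (tpow C D (Suc i) j a (n - a))" if "a \<le> n" for a
    using that by (intro tpow_arr) simp
  have t1: "arr ?X ?Z (tpow C D i j (Suc a) (n - a))" if "a \<le> n" for a
    using that by (intro tpow_arr) simp
  have "tpoly C D (Suc i) j n c \<cdot> (dif C i \<boxtimes>m idm A (gr D j)) =
      finsum (Hom A ?X ?Z) (\<lambda>a. scal ?Y ?Z (c a) (tpow C D (Suc i) j a (n - a)) \<cdot> (dif C i \<boxtimes>m idm A (gr D j))) {..n}"
    unfolding tpoly_def add_Suc using t by (intro comp_sum_left[OF d tensor_gr_ob[OF C D]]) (auto intro: scal_arr)
  also have "\<dots> = finsum (Hom A ?X ?Z) (\<lambda>a. scal ?X ?Z (c a) (tpow C D i j (Suc a) (n - a))) {..n}"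
  proof (rule sum_cong[OF summand_ob[OF C D] tensor_gr_ob[OF C D]], goal_cases)
    case (1 a)
    with t1 show ?case by (auto intro!: scal_arr)
  next
    case (2 a)
    then have a: "a \<le> n" by simp
    show ?case
      using tpow_precomp[of i 1 j 0 a "n - a"]
      by (simp add: comp_scal_left[OF d t[OF a]] arr_comp_id(1)[OF dif_arr[OF C]])
  qed
  finally show ?thesis by (simp add: tpoly_shift)
qed

lemma tpoly_precomp_right:
  "tpoly C D i (Suc j) n c \<cdot> (idm A (gr C i) \<boxtimes>m dif D j) =
    tpoly C D i j (Suc n) (\<lambda>a. if a \<le> n then c a else 0)"
proof -
  let ?N = "Suc (i + j + n)"
  let ?X = "summ C D i j" and ?Y = "summ C D i (Suc j)" and ?Z = "tgr C D ?N"
  have d: "arr ?X ?Y (idm A (gr C i) \<boxtimes>m dif D j)"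
    by (intro tens_arr dif_arr C D id_arr gr_ob)
  have t: "arr ?Y ?Z (tpow C D i (Suc j) a (n - a))" if "a \<le> n" for a
    using that by (intro tpow_arr) simp
  have t1: "arr ?X ?Z (tpow C D i j a (Suc (n - a)))" if "a \<le> n" for a
    using that by (intro tpow_arr) simp
  have "tpoly C D i (Suc j) n c \<cdot> (idm A (gr C i) \<boxtimes>m dif D j) =
      finsum (Hom A ?X ?Z) (\<lambda>a. scal ?Y ?Z (c a) (tpow C D i (Suc j) a (n - a)) \<cdot> (idm A (gr C i) \<boxtimes>m dif D j)) {..n}"
    unfolding tpoly_def add_Suc add_Suc_right using t by (intro comp_sum_left[OF d tensor_gr_ob[OF C D]]) (auto intro: scal_arr)
  also have "\<dots> = finsum (Hom A ?X ?Z) (\<lambda>a. scal ?X ?Z (c a) (tpow C D i j a (Suc (n - a)))) {..n}"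
  proof (rule sum_cong[OF summand_ob[OF C D] tensor_gr_ob[OF C D]], goal_cases)
    case (1 a)
    with t1 show ?case by (auto intro!: scal_arr)
  next
    case (2 a)
    then have a: "a \<le> n" by simp
    show ?case
      using tpow_precomp[of i 0 j 1 a "n - a"]
      by (simp add: comp_scal_left[OF d t[OF a]] arr_comp_id(1)[OF dif_arr[OF D]])
  qed
  finally show ?thesis by (simp add: tpoly_top)
qed

lemma tpoly_zero: "tpoly C D i j 0 (\<lambda>a. if a = 0 then 1 else 0) = tinj C D i j"
  using tpoly_single[of 0 0 i j] by (simp add: tpow_zero_zero)

lemma pdpow_arr: "n + k = N \<Longrightarrow> arr (tgr C D n) (tgr C D N) (dpow A (p_tensor A S C D) n k)"
  using dpow_arr[OF p_tensor_graded[OF C D], of n k] by (auto simp: p_tensor_def)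

text \<open>
  This is the binomial theorem for \<open>(x + y)\<^sup>k\<close>; the step is Pascal's rule.
\<close>

lemma pdpow_tinj:
  "dpow A (p_tensor A S C D) (i + j) k \<cdot> tinj C D i j = tpoly C D i j k (\<lambda>a. int (k choose a))"
proof (induction k)
  case 0
  have "tpoly C D i j 0 (\<lambda>a. int (0 choose a)) = tpoly C D i j 0 (\<lambda>a. if a = 0 then 1 else 0)"
    by (rule tpoly_cong) simp
  then show ?case
    using arr_comp_id(2)[OF tinj_arr[OF C D]] by (simp add: tpoly_zero p_tensor_def)
next
  case (Suc k)
  have "dpow A (p_tensor A S C D) (i + j) (Suc k) \<cdot> tinj C D i j =
      pdif C D (i + j + k) \<cdot> (dpow A (p_tensor A S C D) (i + j) k \<cdot> tinj C D i j)"
    unfolding dpow.simps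
    using arr_comp_assoc[OF tinj_arr[OF C D] pdpow_arr[OF refl], of i j k]
      dif_arr[OF p_tensor_graded[OF C D], of "i + j + k"] by (simp add: p_tensor_def)
  also have "\<dots> = tpoly C D i j (Suc k)
      (\<lambda>a. (if a = 0 then 0 else int (k choose (a - 1))) + (if a \<le> k then int (k choose a) else 0))"
    unfolding Suc by (rule pdif_tpoly) simp
  also have "\<dots> = tpoly C D i j (Suc k) (\<lambda>a. int (Suc k choose a))"
  proof (rule tpoly_cong)
    fix a assume "a \<le> Suc k"
    then show "[(if a = 0 then 0 else int (k choose (a - 1))) + (if a \<le> k then int (k choose a) else 0)
        = int (Suc k choose a)] (mod int p)"
      by (cases a) (auto simp: not_le binomial_eq_0)
  qed
  finally show ?case .
qed

text \<open>
  In \<open>(x + y)\<^sup>p\<close> the inner binomial coefficients vanish modulo \<open>p\<close>, and \<open>x\<^sup>p = y\<^sup>p = 0\<close>.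
\<close>

lemma p_tensor_p_complex:
  assumes "p_complex p A C" "p_complex p A D"
  shows "p_complex p A (p_tensor A S C D)"
proof -
  have "dpow A (p_tensor A S C D) n p = \<zero>\<^bsub>Hom A (tgr C D n) (tgr C D (n + p))\<^esub>" for n
  proof (rule tensor_ext[OF C D pdpow_arr[OF refl] zero_arr[OF tensor_gr_ob[OF C D] tensor_gr_ob[OF C D]]])
    fix i j assume n: "i + j = n"
    have p0: "p > 0" using p_gt_1 by simp
    have "dpow A (p_tensor A S C D) n p \<cdot> tinj C D i j = tpoly C D i j p (\<lambda>a. int (p choose a))"
      using pdpow_tinj n by blast
    also have "\<dots> = tpoly C D i j p (\<lambda>a. (if a = 0 then 1 else 0) + (if a = p then 1 else 0))"
    proof (rule tpoly_cong)
      fix a assume "a \<le> p"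
      moreover have "[int (p choose a) = 0] (mod int p)" if "0 < a" "a < p"
        using dvd_choose_prime[OF that(2) _ _ prime_p] that by (simp add: cong_0_iff)
      ultimately show "[int (p choose a) = (if a = 0 then 1 else 0) + (if a = p then 1 else 0)] (mod int p)"
        using p0 by (cases "a = 0"; cases "a = p") auto
    qed
    also have "\<dots> = tpow C D i j 0 p \<oplus>\<^bsub>Hom A (summ C D i j) (tgr C D (n + p))\<^esub> tpow C D i j p 0"
      using n tpoly_single[of 0 p i j] tpoly_single[of p p i j]
      by (subst tpoly_add[of i j p "n + p", symmetric]) simp_all
    also have "\<dots> = \<zero>\<^bsub>Hom A (summ C D i j) (tgr C D (n + p))\<^esub>"
      using tpow_vanish[OF assms, of 0 p i j "n + p"] tpow_vanish[OF assms, of p 0 i j "n + p"] n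
        add_zero[OF zero_arr[OF summand_ob[OF C D] tensor_gr_ob[OF C D]]] by simp
    also have "\<dots> = \<zero>\<^bsub>Hom A (tgr C D n) (tgr C D (n + p))\<^esub> \<cdot> tinj C D i j"
      using comp_zero(2)[OF tensor_gr_ob[OF C D, of "n + p"] tinj_arr[OF C D, of i j]] n by simp
    finally show "dpow A (p_tensor A S C D) n p \<cdot> tinj C D i j =
        \<zero>\<^bsub>Hom A (tgr C D n) (tgr C D (n + p))\<^esub> \<cdot> tinj C D i j" .
  qed
  then show ?thesis
    using p_tensor_graded[OF C D] by (simp add: p_complex_def p_tensor_def)
qed

text \<open>
  Since \<open>x\<^sup>2 = y\<^sup>2 = 0\<close>, only the two mixed terms \<open>x y\<close> of the square remain; their signs differ
  because \<open>x\<close> raises the first degree by one.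
\<close>

lemma cochain_tensor_cochain:
  assumes "cochain_complex A C" "cochain_complex A D"
  shows "cochain_complex A (cochain_tensor A S C D)"
proof -
  have two: "p_complex 2 A B" if "cochain_complex A B" for B
    using that arr_comp_id(1)[OF dif_arr] by (auto simp: cochain_complex_def p_complex_def numeral_2_eq_2)
  note vanish = tpow_vanish[OF two[OF assms(1)] two[OF assms(2)]]
  let ?d = "\<lambda>n. tensor_dif odd A S C D n"
  have "?d (Suc n) \<cdot> ?d n = \<zero>\<^bsub>Hom A (tgr C D n) (tgr C D (Suc (Suc n)))\<^esub>" for n
  proof (rule tensor_ext[OF C D])
    note d = tensor_dif_arr[OF C D, of _ odd]
    show "arr (tgr C D n) (tgr C D (Suc (Suc n))) (?d (Suc n) \<cdot> ?d n)"
      by (rule comp_arr[OF d d])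
    show "arr (tgr C D n) (tgr C D (Suc (Suc n))) \<zero>\<^bsub>Hom A (tgr C D n) (tgr C D (Suc (Suc n)))\<^esub>"
      by (rule zero_arr[OF tensor_gr_ob[OF C D] tensor_gr_ob[OF C D]])
    fix i j assume n: "i + j = n"
    let ?X = "summ C D i j" and ?Y = "tgr C D (Suc n)" and ?Z = "tgr C D (Suc (Suc n))"
    let ?\<epsilon> = "if odd i then - 1 else (1 :: int)" and ?xy = "tpow C D i j 1 1"
    have x: "arr ?X ?Y (tpow C D i j 1 0)" and y: "arr ?X ?Y (tpow C D i j 0 1)" and xy: "arr ?X ?Z ?xy"
      using n by (auto intro!: tpow_arr)
    have z: "arr ?X ?Z \<zero>\<^bsub>Hom A ?X ?Z\<^esub>" by (rule zero_arr[OF summand_ob[OF C D] tensor_gr_ob[OF C D]])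
    have "(?d (Suc n) \<cdot> ?d n) \<cdot> tinj C D i j = ?d (Suc n) \<cdot> (?d n \<cdot> tpow C D i j 0 0)"
      unfolding tpow_zero_zero n[symmetric] by (rule arr_comp_assoc[OF tinj_arr[OF C D] d d])
    also have "?d n \<cdot> tpow C D i j 0 0 =
        tpow C D i j 1 0 \<oplus>\<^bsub>Hom A ?X ?Y\<^esub> scal ?X ?Y ?\<epsilon> (tpow C D i j 0 1)"
      using tensor_dif_tpow[of i j 0 0 n odd] n by simp
    also have "?d (Suc n) \<cdot> \<dots> =
        ?d (Suc n) \<cdot> tpow C D i j 1 0 \<oplus>\<^bsub>Hom A ?X ?Z\<^esub> scal ?X ?Z ?\<epsilon> (?d (Suc n) \<cdot> tpow C D i j 0 1)"
      unfolding arr_comp_add_right[OF x scal_arr[OF y] d] comp_scal_right[OF y d] ..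
    also have "?d (Suc n) \<cdot> tpow C D i j 1 0 = scal ?X ?Z (- ?\<epsilon>) ?xy"
      using tensor_dif_tpow[of i j 1 0 "Suc n" odd] vanish[of "Suc (Suc 0)" 0 i j "Suc (Suc n)"] n
        add_zero(2)[OF scal_arr[OF xy]] by simp
    also have "?d (Suc n) \<cdot> tpow C D i j 0 1 = ?xy"
      using tensor_dif_tpow[of i j 0 1 "Suc n" odd] vanish[of 0 "Suc (Suc 0)" i j "Suc (Suc n)"] n
        add_zero(1)[OF xy] by (simp add: scal_zero_right[OF summand_ob[OF C D] tensor_gr_ob[OF C D]])
    also have "scal ?X ?Z (- ?\<epsilon>) ?xy \<oplus>\<^bsub>Hom A ?X ?Z\<^esub> scal ?X ?Z ?\<epsilon> ?xy = \<zero>\<^bsub>Hom A ?X ?Z\<^esub>"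
      unfolding scal_add[OF xy, symmetric] using scal_zero[OF xy] by simp
    also have "\<dots> = \<zero>\<^bsub>Hom A (tgr C D n) ?Z\<^esub> \<cdot> tinj C D i j"
      using comp_zero(2)[OF tensor_gr_ob[OF C D, of "Suc (Suc n)"] tinj_arr[OF C D, of i j]] n by simp
    finally show "(?d (Suc n) \<cdot> ?d n) \<cdot> tinj C D i j = \<zero>\<^bsub>Hom A (tgr C D n) ?Z\<^esub> \<cdot> tinj C D i j" .
  qed
  then show ?thesis
    using cochain_tensor_graded[OF C D] by (simp add: cochain_complex_def cochain_tensor_def)
qed

end

lemma tensor_mor_cotuple:
  "tensor_mor A S C D C' D' f g n = finsum (Hom A (tgr C D n) (tgr C' D' n))
     (\<lambda>i. tinj C' D' i (n - i) \<cdot> ((f i \<boxtimes>m g (n - i)) \<cdot> sprj S (tensor_summands A C D n) i)) {..n}"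
  if "graded_with_dif A C" "graded_with_dif A D" "graded_with_dif A C'" "graded_with_dif A D'"
    "\<And>i. arr (gr C i) (gr C' i) (f i)" "\<And>i. arr (gr D i) (gr D' i) (g i)"
  unfolding tensor_mor_def
proof (rule sum_cong, goal_cases)
  case (3 i)
  then show ?case
    using tinj_arr[OF that(3,4), of i "n - i"]
    by (intro comp_arr[OF comp_arr[OF tprj_arr[OF that(1,2)] tens_arr[OF that(5,6)]]]) simp_all
qed (auto simp: tinj_def that intro!: tensor_gr_ob)

lemma tensor_mor:
  assumes C: "graded_with_dif A C" and D: "graded_with_dif A D"
    and C': "graded_with_dif A C'" and D': "graded_with_dif A D'"
    and f: "\<And>i. arr (gr C i) (gr C' i) (f i)" and g: "\<And>i. arr (gr D i) (gr D' i) (g i)"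
  shows tensor_mor_arr: "arr (tgr C D n) (tgr C' D' n) (tensor_mor A S C D C' D' f g n)"
    and tensor_mor_tinj: "i + j = n \<Longrightarrow>
      tensor_mor A S C D C' D' f g n \<cdot> tinj C D i j = tinj C' D' i j \<cdot> (f i \<boxtimes>m g j)"
proof -
  have t: "arr (summ C D i j) (tgr C' D' n) (tinj C' D' i j \<cdot> (f i \<boxtimes>m g j))" if "i + j = n" for i j
    using comp_arr[OF tens_arr[OF f g] tinj_arr[OF C' D'], of i j] that by simp
  have eq: "tensor_mor A S C D C' D' f g n =
      cotuple C D n (tgr C' D' n) (\<lambda>i j. tinj C' D' i j \<cdot> (f i \<boxtimes>m g j))"
    unfolding tensor_mor_cotuple[OF assms] cotuple_def
  proof (rule sum_cong[OF tensor_gr_ob[OF C D] tensor_gr_ob[OF C' D']], goal_cases)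
    case (1 i)
    then show ?case using comp_arr[OF tprj_arr[OF C D] t, of i n] by simp
  next
    case (2 i)
    then show ?case
      using arr_comp_assoc[OF tprj_arr[OF C D] tens_arr[OF f g] tinj_arr[OF C' D'], of i n, symmetric]
      by simp
  qed
  show "arr (tgr C D n) (tgr C' D' n) (tensor_mor A S C D C' D' f g n)"
    unfolding eq by (rule cotuple_arr[OF C D tensor_gr_ob[OF C' D'] t])
  show "i + j = n \<Longrightarrow>
      tensor_mor A S C D C' D' f g n \<cdot> tinj C D i j = tinj C' D' i j \<cdot> (f i \<boxtimes>m g j)"
    unfolding eq by (rule cotuple_tinj[OF C D tensor_gr_ob[OF C' D'] t])
qed

text \<open>
  A tensor product of morphisms commutes with the partial differentials, hence with every
  polynomial in them.  Naturality of the comparison morphism rests on this.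
\<close>

lemma tensor_mor_tpoly:
  assumes C: "graded_with_dif A C" and D: "graded_with_dif A D"
    and C': "graded_with_dif A C'" and D': "graded_with_dif A D'"
    and f: "dif_morphism A C C' f" and g: "dif_morphism A D D' g"
    and N: "i + j + n = N"
  shows "tensor_mor A S C D C' D' f g N \<cdot> tpoly C D i j n c = tpoly C' D' i j n c \<cdot> (f i \<boxtimes>m g j)"
proof -
  have arrs: "\<And>i. arr (gr C i) (gr C' i) (f i)" "\<And>i. arr (gr D i) (gr D' i) (g i)"
    using f g gr_ob C D C' D' by (auto simp: dif_morphism_def arr_def)
  have pow: "h (i + a) \<cdot> dpow A B i a = dpow A B' i a \<cdot> h i"
    if B: "graded_with_dif A B" and B': "graded_with_dif A B'" and h: "dif_morphism A B B' h"
    for B B' h i a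
  proof (induction a)
    case 0
    have "arr (gr B i) (gr B' i) (h i)" using h gr_ob B B' by (auto simp: dif_morphism_def arr_def)
    then show ?case by (simp add: arr_comp_id)
  next
    case (Suc a)
    have ha: "arr (gr B i) (gr B' i) (h i)" for i using h gr_ob B B' by (auto simp: dif_morphism_def arr_def)
    note d = dif_arr[OF B, of "i + a"] dif_arr[OF B', of "i + a"]
    have "h (i + Suc a) \<cdot> dpow A B i (Suc a) = (h (Suc (i + a)) \<cdot> dif B (i + a)) \<cdot> dpow A B i a"
      using arr_comp_assoc[OF dpow_arr[OF B] d(1) ha] by simp
    also have "h (Suc (i + a)) \<cdot> dif B (i + a) = dif B' (i + a) \<cdot> h (i + a)"
      using h by (simp add: dif_morphism_def)
    also have "\<dots> \<cdot> dpow A B i a = dif B' (i + a) \<cdot> (dpow A B' i a \<cdot> h i)"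
      using arr_comp_assoc[OF dpow_arr[OF B] ha d(2)] Suc by simp
    also have "\<dots> = dpow A B' i (Suc a) \<cdot> h i"
      using arr_comp_assoc[OF ha dpow_arr[OF B'] d(2)] by simp
    finally show ?case .
  qed
  let ?F = "tensor_mor A S C D C' D' f g N" and ?X = "summ C D i j" and ?Y = "tgr C D N"
    and ?X' = "summ C' D' i j" and ?Y' = "tgr C' D' N"
  note F = tensor_mor_arr[OF C D C' D' arrs, of N]
  note fg = tens_arr[OF arrs(1)[of i] arrs(2)[of j]]
  have t: "arr ?X ?Y (tpow C D i j a (n - a))" "arr ?X' ?Y' (tpow C' D' i j a (n - a))" if "a \<le> n" for a
    using that N by (auto intro!: tpow_arr C D C' D')
  have tpow: "?F \<cdot> tpow C D i j a b = tpow C' D' i j a b \<cdot> (f i \<boxtimes>m g j)" if ab: "a + b = n" for a b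
  proof -
    note d = tens_arr[OF dpow_arr[OF C, of i a] dpow_arr[OF D, of j b]]
    note d' = tens_arr[OF dpow_arr[OF C', of i a] dpow_arr[OF D', of j b]]
    have N': "i + a + (j + b) = N" using ab N by simp
    have F': "arr (tgr C D (i + a + (j + b))) ?Y' ?F"
      using F N' by simp
    note fg' = tens_arr[OF arrs(1)[of "i + a"] arrs(2)[of "j + b"]]
    have "?F \<cdot> tpow C D i j a b = (?F \<cdot> tinj C D (i + a) (j + b)) \<cdot> (dpow A C i a \<boxtimes>m dpow A D j b)"
      unfolding tpow_def by (rule arr_comp_assoc[OF d tinj_arr[OF C D] F', symmetric])
    also have "?F \<cdot> tinj C D (i + a) (j + b) = tinj C' D' (i + a) (j + b) \<cdot> (f (i + a) \<boxtimes>m g (j + b))"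
      by (rule tensor_mor_tinj[OF C D C' D' arrs N'])
    also have "\<dots> \<cdot> (dpow A C i a \<boxtimes>m dpow A D j b) =
        tinj C' D' (i + a) (j + b) \<cdot> ((f (i + a) \<boxtimes>m g (j + b)) \<cdot> (dpow A C i a \<boxtimes>m dpow A D j b))"
      by (rule arr_comp_assoc[OF d fg' tinj_arr[OF C' D']])
    also have "(f (i + a) \<boxtimes>m g (j + b)) \<cdot> (dpow A C i a \<boxtimes>m dpow A D j b) =
        (dpow A C' i a \<boxtimes>m dpow A D' j b) \<cdot> (f i \<boxtimes>m g j)"
      unfolding tens_comp[OF dpow_arr[OF C] arrs(1) dpow_arr[OF D] arrs(2)]
        tens_comp[OF arrs(1) dpow_arr[OF C'] arrs(2) dpow_arr[OF D']]
        pow[OF C C' f] pow[OF D D' g] ..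
    also have "tinj C' D' (i + a) (j + b) \<cdot> \<dots> = tpow C' D' i j a b \<cdot> (f i \<boxtimes>m g j)"
      unfolding tpow_def by (rule arr_comp_assoc[OF fg d' tinj_arr[OF C' D'], symmetric])
    finally show ?thesis .
  qed
  have "?F \<cdot> tpoly C D i j n c =
      finsum (Hom A ?X ?Y') (\<lambda>a. ?F \<cdot> scal ?X ?Y (c a) (tpow C D i j a (n - a))) {..n}"
    unfolding tpoly_def N using t by (intro comp_sum_right[OF arr_ob(1)[OF fg] F]) (auto intro: scal_arr)
  also have "\<dots> = finsum (Hom A ?X ?Y') (\<lambda>a. scal ?X' ?Y' (c a) (tpow C' D' i j a (n - a)) \<cdot> (f i \<boxtimes>m g j)) {..n}"
  proof (rule sum_cong[OF arr_ob(1)[OF fg] arr_ob(2)[OF F]], goal_cases)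
    case (1 a)
    with t show ?case by (auto intro!: comp_arr[OF fg] scal_arr)
  next
    case (2 a)
    then have a: "a \<le> n" by simp
    show ?case
      using a by (simp add: comp_scal_right[OF t(1)[OF a] F] comp_scal_left[OF fg t(2)[OF a]] tpow)
  qed
  also have "\<dots> = tpoly C' D' i j n c \<cdot> (f i \<boxtimes>m g j)"
    unfolding tpoly_def N using t
    by (intro comp_sum_left[OF fg arr_ob(2)[OF F], symmetric]) (auto intro: scal_arr)
  finally show ?thesis .
qed


section \<open>The comparison morphism\<close>

text \<open>
  The contraction index \<open>1\<close> is written \<open>Suc 0\<close>, the form to which the simplifier rewrites it.
\<close>

abbreviation "ctr C \<equiv> contraction p A (Suc 0) C"
abbreviation "cd n \<equiv> cdeg p (Suc 0) n"

text \<open>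
  The number of degrees of \<open>C \<otimes> D\<close> between the summand \<open>(i, j)\<close> of \<open>C\<^sub>[\<^sub>1\<^sub>] \<otimes> D\<^sub>[\<^sub>1\<^sub>]\<close> and the term
  of \<open>(C \<otimes> D)\<^sub>[\<^sub>1\<^sub>]\<close> in degree \<open>i + j\<close>; see \<open>cdeg_gap\<close>.
\<close>

definition gap :: "nat \<Rightarrow> nat \<Rightarrow> nat" where
  "gap i j = (if odd i \<and> odd j then p - 2 else 0)"

text \<open>
  For odd \<open>i\<close> and \<open>j\<close> these are the coefficients of the polynomial \<open>q\<close>, which fills the gap.  They
  are forced by \<open>x\<^sup>p\<^sup>-\<^sup>1 - q y = (x + y)\<^sup>p\<^sup>-\<^sup>1\<close>.  Otherwise the polynomial is the constant \<open>1\<close>.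
\<close>

definition gap_coeff :: "nat \<Rightarrow> nat \<Rightarrow> nat \<Rightarrow> int" where
  "gap_coeff i j a = (if odd i \<and> odd j then - ((- 1) ^ a) else 1)"

definition comparison_column :: "('o, 'm) cpx \<Rightarrow> ('o, 'm) cpx \<Rightarrow> nat \<Rightarrow> nat \<Rightarrow> 'm" where
  "comparison_column C D i j = tpoly C D (cd i) (cd j) (gap i j) (gap_coeff i j)"

definition comparison :: "('o, 'm) cpx \<Rightarrow> ('o, 'm) cpx \<Rightarrow> nat \<Rightarrow> 'm" where
  "comparison C D n = cotuple (ctr C) (ctr D) n (tgr C D (cd n)) (comparison_column C D)"

lemma cdeg_gap: "cd i + cd j + gap i j = cd (i + j)"
proof -
  have "p \<ge> 2" using p_gt_1 by simp
  then have "p + p * k = Suc (Suc (p - 2 + p * k))" for k by simp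
  then show ?thesis
    by (cases "even i"; cases "even j")
      (auto simp: cdeg_def gap_def distrib_left elim!: oddE evenE)
qed

lemma one_le_p: "Suc 0 \<le> p"
  using p_gt_1 by simp

lemma cdeg_Suc: "s \<le> p \<Longrightarrow> cdeg p s (Suc i) = cdeg p s i + (if even i then s else p - s)"
  by (auto simp: cdeg_def elim!: oddE)

lemma contraction_simps:
  "gr (contraction p A s C) n = gr C (cdeg p s n)"
  "dif (contraction p A s C) n = dpow A C (cdeg p s n) (if even n then s else p - s)"
  by (simp_all add: contraction_def)

context
  fixes C D :: "('o, 'm) cpx"
  assumes C: "graded_with_dif A C" and D: "graded_with_dif A D"
begin

lemma ctr_graded: "graded_with_dif A (ctr C)" "graded_with_dif A (ctr D)"
  using p_gt_1 by (auto intro!: contraction_graded C D)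

lemma comparison_column_arr:
  "i + j = n \<Longrightarrow> arr (summ (ctr C) (ctr D) i j) (tgr C D (cd n)) (comparison_column C D i j)"
  unfolding comparison_column_def contraction_simps using cdeg_gap tpoly_arr[OF C D] by blast

lemma comparison_arr: "arr (tgr (ctr C) (ctr D) n) (tgr C D (cd n)) (comparison C D n)"
  unfolding comparison_def by (rule cotuple_arr[OF ctr_graded tensor_gr_ob[OF C D] comparison_column_arr])

lemma comparison_tinj:
  "i + j = n \<Longrightarrow> comparison C D n \<cdot> tinj (ctr C) (ctr D) i j = comparison_column C D i j"
  unfolding comparison_def by (rule cotuple_tinj[OF ctr_graded tensor_gr_ob[OF C D] comparison_column_arr])

lemma comparison_column_tinj:
  assumes "even i \<or> even j"
  shows "comparison_column C D i j = tinj C D (cd i) (cd j)"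
proof -
  have "comparison_column C D i j = tpoly C D (cd i) (cd j) 0 (\<lambda>a. if a = 0 then 1 else 0)"
    unfolding comparison_column_def using assms by (auto simp: gap_def gap_coeff_def intro!: tpoly_cong[OF C D])
  then show ?thesis by (simp add: tpoly_zero[OF C D])
qed

text \<open>
  The term with \<open>d \<otimes> 1\<close> in \<open>h \<cdot> d\<close>, as a polynomial.  For even \<open>i\<close> the differential of \<open>C\<^sub>[\<^sub>1\<^sub>]\<close> is
  \<open>x\<close>, which multiplies the polynomial at \<open>(i + 1, j)\<close>; for odd \<open>i\<close> it is \<open>x\<^sup>p\<^sup>-\<^sup>1\<close>, and the polynomial
  at \<open>(i + 1, j)\<close> is \<open>1\<close>.
\<close>

lemma comparison_column_left:
  "comparison_column C D (Suc i) j \<cdot> (dif (ctr C) i \<boxtimes>m idm A (gr (ctr D) j)) =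
    tpoly C D (cd i) (cd j) (if even i then Suc (gap (Suc i) j) else p - 1)
      (\<lambda>a. if even i then (if a = 0 then 0 else gap_coeff (Suc i) j (a - 1))
           else (if a = p - 1 then 1 else 0))"
proof (cases "even i")
  case True
  then show ?thesis
    using tpoly_precomp_left[OF C D, of "cd i" "cd j"]
    by (simp add: comparison_column_def contraction_simps cdeg_Suc one_le_p arr_comp_id(1)[OF dif_arr[OF C]])
next
  case False
  then show ?thesis
    using tpow_precomp[OF C D, of "cd i" "p - 1" "cd j" 0 0 0] tpoly_single[OF C D, of "p - 1" "p - 1" "cd i" "cd j"]
    by (simp add: comparison_column_tinj tpow_zero_zero[OF C D] contraction_simps cdeg_Suc one_le_p)
qed

lemma comparison_column_right:
  "comparison_column C D i (Suc j) \<cdot> (idm A (gr (ctr C) i) \<boxtimes>m dif (ctr D) j) =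
    tpoly C D (cd i) (cd j) (if even j then Suc (gap i (Suc j)) else p - 1)
      (\<lambda>a. if even j then (if a \<le> gap i (Suc j) then gap_coeff i (Suc j) a else 0)
           else (if a = 0 then 1 else 0))"
proof (cases "even j")
  case True
  then show ?thesis
    using tpoly_precomp_right[OF C D, of "cd i" "cd j"]
    by (simp add: comparison_column_def contraction_simps cdeg_Suc one_le_p arr_comp_id(1)[OF dif_arr[OF D]])
next
  case False
  then show ?thesis
    using tpow_precomp[OF C D, of "cd i" 0 "cd j" "p - 1" 0 0] tpoly_single[OF C D, of 0 "p - 1" "cd i" "cd j"]
    by (simp add: comparison_column_tinj tpow_zero_zero[OF C D] contraction_simps cdeg_Suc one_le_p)
qed

text \<open>
  The other side \<open>d \<cdot> h\<close>: \<open>(x + y) q = x\<^sup>p\<^sup>-\<^sup>1 - y\<^sup>p\<^sup>-\<^sup>1\<close> when both indices are odd, because the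
  product telescopes, and a power of \<open>x + y\<close> otherwise.
\<close>

lemma comparison_column_dif:
  "dif (ctr (p_tensor A S C D)) (i + j) \<cdot> comparison_column C D i j =
    tpoly C D (cd i) (cd j) (if even i \<and> even j then 1 else p - 1)
      (\<lambda>a. if odd i \<and> odd j then (if a = 0 then - 1 else if a = p - 1 then 1 else 0)
           else if even i \<and> even j then 1 else (- 1) ^ a)"
proof (cases "odd i \<and> odd j")
  case True
  define n where "n = p - 2"
  have n: "p - 2 = n" "p - Suc 0 = Suc n" using p_gt_1 by (simp_all add: n_def)
  have oo: "even (i + j)" using True by simp
  have "dif (ctr (p_tensor A S C D)) (i + j) = pdif C D (cd (i + j))"
    using oo arr_comp_id(1)[OF dif_arr[OF p_tensor_graded[OF C D]], of "cd (i + j)"]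
    by (simp add: contraction_simps)
  then have "dif (ctr (p_tensor A S C D)) (i + j) \<cdot> comparison_column C D i j =
      tpoly C D (cd i) (cd j) (Suc (gap i j))
       (\<lambda>a. (if a = 0 then 0 else gap_coeff i j (a - 1)) + (if a \<le> gap i j then gap_coeff i j a else 0))"
    unfolding comparison_column_def by (simp only: pdif_tpoly[OF C D cdeg_gap])
  also have "\<dots> = tpoly C D (cd i) (cd j) (p - 1) (\<lambda>a. if a = 0 then - 1 else if a = p - 1 then 1 else 0)"
  proof -
    have g: "Suc (gap i j) = p - 1" using True n by (simp add: gap_def)
    show ?thesis
      unfolding g
    proof (rule tpoly_cong[OF C D])
      fix a assume "a \<le> p - 1"
      then consider "a = 0" | "a \<noteq> 0" "a \<le> n" | "a = Suc n" using n by linarith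
      then show "[(if a = 0 then 0 else gap_coeff i j (a - 1)) + (if a \<le> gap i j then gap_coeff i j a else 0) =
          (if a = 0 then - 1 else if a = p - 1 then 1 else 0)] (mod int p)"
      proof cases
        case 2
        then show ?thesis using True n by (cases a) (auto simp: gap_def gap_coeff_def)
      next
        case 3
        then show ?thesis using True n minus_one_power_cong[OF prime_p] by (simp add: gap_def gap_coeff_def)
      qed (use True in \<open>simp add: gap_def gap_coeff_def\<close>)
    qed
  qed
  finally show ?thesis using True by auto
next
  case False
  let ?k = "if even i \<and> even j then 1 else p - 1"
  have "even (i + j) \<longleftrightarrow> even i \<and> even j" using False by auto
  moreover have "cd (i + j) = cd i + cd j"
    using cdeg_gap[of i j] False by (simp add: gap_def)
  ultimately have "dif (ctr (p_tensor A S C D)) (i + j) = dpow A (p_tensor A S C D) (cd i + cd j) ?k"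
    by (simp only: contraction_simps One_nat_def)
  then have "dif (ctr (p_tensor A S C D)) (i + j) \<cdot> comparison_column C D i j =
      tpoly C D (cd i) (cd j) ?k (\<lambda>a. int (?k choose a))"
    using False by (simp only: comparison_column_tinj pdpow_tinj[OF C D] de_Morgan_conj not_not)
  also have "\<dots> = tpoly C D (cd i) (cd j) ?k (\<lambda>a. if even i \<and> even j then 1 else (- 1) ^ a)"
  proof (rule tpoly_cong[OF C D])
    fix a assume "a \<le> ?k"
    then show "[int (?k choose a) = (if even i \<and> even j then 1 else (- 1) ^ a)] (mod int p)"
      using prime_choose_minus_1_cong[OF prime_p, of a] by (cases a) auto
  qed
  finally show ?thesis using False by (simp only: if_False)
qed

text \<open>
  The four polynomial identities behind the construction, compared coefficient by coefficient.
\<close>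

lemma comparison_column_chain:
  assumes "i + j = n"
  shows "comparison_column C D (Suc i) j \<cdot> (dif (ctr C) i \<boxtimes>m idm A (gr (ctr D) j))
      \<oplus>\<^bsub>Hom A (summ (ctr C) (ctr D) i j) (tgr C D (cd (Suc n)))\<^esub>
      scal (summ (ctr C) (ctr D) i j) (tgr C D (cd (Suc n))) (if odd i then - 1 else 1)
        (comparison_column C D i (Suc j) \<cdot> (idm A (gr (ctr C) i) \<boxtimes>m dif (ctr D) j)) =
    dif (ctr (p_tensor A S C D)) n \<cdot> comparison_column C D i j"
proof -
  define m where "m = p - 2"
  have m: "p - 2 = m" "p - Suc 0 = Suc m" using p_gt_1 by (simp_all add: m_def)
  let ?k = "if even i \<and> even j then 1 else p - 1"
  have k: "(if even i then Suc (gap (Suc i) j) else p - 1) = ?k"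
    "(if even j then Suc (gap i (Suc j)) else p - 1) = ?k"
    using m by (auto simp: gap_def)
  have N: "cd i + cd j + ?k = cd (Suc n)"
    using cdeg_gap[of i j] cdeg_Suc[OF one_le_p, of n] one_le_p assms m by (auto simp: gap_def split: if_splits)
  show ?thesis
    unfolding comparison_column_left comparison_column_right comparison_column_dif[of i j, unfolded assms] k
    unfolding contraction_simps tpoly_scal[OF C D N] tpoly_add[OF C D N]
  proof (rule tpoly_cong[OF C D])
    fix a assume a: "a \<le> ?k"
    show "[(if even i then if a = 0 then 0 else gap_coeff (Suc i) j (a - 1) else if a = p - 1 then 1 else 0) +
         (if odd i then - 1 else 1) *
         (if even j then if a \<le> gap i (Suc j) then gap_coeff i (Suc j) a else 0 else if a = 0 then 1 else 0) =
        (if odd i \<and> odd j then if a = 0 then - 1 else if a = p - 1 then 1 else 0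
         else if even i \<and> even j then 1 else (- 1) ^ a)] (mod int p)"
    proof (cases "even i"; cases "even j")
      assume "even i" "even j"
      then show ?thesis using a by (cases a) (auto simp: gap_def gap_coeff_def)
    next
      assume "even i" "odd j"
      then show ?thesis using a by (cases a) (auto simp: gap_def gap_coeff_def)
    next
      assume h: "odd i" "even j"
      show ?thesis
      proof (cases "a = p - 1")
        case True
        then show ?thesis using h m minus_one_power_cong[OF prime_p] by (simp add: gap_def gap_coeff_def cong_sym)
      next
        case False
        then show ?thesis using a h m by (auto simp: gap_def gap_coeff_def)
      qed
    next
      assume "odd i" "odd j"
      then show ?thesis using a m by auto
    qed
  qed
qed

lemma comparison_chain:
  "comparison C D (Suc n) \<cdot> dif (cochain_tensor A S (ctr C) (ctr D)) n =
    dif (ctr (p_tensor A S C D)) n \<cdot> comparison C D n"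
proof -
  let ?T = "tensor_dif odd A S (ctr C) (ctr D)" and ?U = "dif (ctr (p_tensor A S C D)) n"
  note T = tensor_dif_arr[OF ctr_graded, of _ odd]
  have "graded_with_dif A (ctr (p_tensor A S C D))"
    using p_gt_1 by (intro contraction_graded p_tensor_graded C D) simp
  from dif_arr[OF this, of n]
  have U: "arr (tgr C D (cd n)) (tgr C D (cd (Suc n))) ?U"
    unfolding contraction_simps(1) by (simp add: p_tensor_def)
  note H = comparison_arr and J = tinj_arr[OF ctr_graded]
  have "comparison C D (Suc n) \<cdot> ?T n = ?U \<cdot> comparison C D n"
  proof (rule tensor_ext[OF ctr_graded comp_arr[OF T H] comp_arr[OF H U]])
    fix i j assume n: "i + j = n"
    let ?x = "dif (ctr C) i \<boxtimes>m idm A (gr (ctr D) j)" and ?y = "idm A (gr (ctr C) i) \<boxtimes>m dif (ctr D) j"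
    let ?X = "summ (ctr C) (ctr D) i j" and ?Y = "tgr (ctr C) (ctr D) (Suc n)"
    have x: "arr ?X (summ (ctr C) (ctr D) (Suc i) j) ?x" and y: "arr ?X (summ (ctr C) (ctr D) i (Suc j)) ?y"
      by (intro tens_arr dif_arr id_arr gr_ob ctr_graded)+
    have Jx: "arr (summ (ctr C) (ctr D) (Suc i) j) ?Y (tinj (ctr C) (ctr D) (Suc i) j)"
      and Jy: "arr (summ (ctr C) (ctr D) i (Suc j)) ?Y (tinj (ctr C) (ctr D) i (Suc j))"
      and Jn: "arr ?X (tgr (ctr C) (ctr D) n) (tinj (ctr C) (ctr D) i j)"
      using J[of "Suc i" j] J[of i "Suc j"] J[of i j] n by simp_all
    note xy = comp_arr[OF x Jx] comp_arr[OF y Jy]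
    have "(comparison C D (Suc n) \<cdot> ?T n) \<cdot> tinj (ctr C) (ctr D) i j =
        comparison C D (Suc n) \<cdot> (?T n \<cdot> tinj (ctr C) (ctr D) i j)"
      by (rule arr_comp_assoc[OF Jn T H])
    also have "?T n \<cdot> tinj (ctr C) (ctr D) i j = tinj (ctr C) (ctr D) (Suc i) j \<cdot> ?x
        \<oplus>\<^bsub>Hom A ?X ?Y\<^esub> scal ?X ?Y (if odd i then - 1 else 1) (tinj (ctr C) (ctr D) i (Suc j) \<cdot> ?y)"
      using tensor_dif_tinj[OF ctr_graded, of odd i j] unfolding n .
    also have "comparison C D (Suc n) \<cdot> \<dots> = ?U \<cdot> comparison_column C D i j"
      using n unfolding arr_comp_add_right[OF xy(1) scal_arr[OF xy(2)] H] comp_scal_right[OF xy(2) H]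
        arr_comp_assoc[OF x Jx H, symmetric] arr_comp_assoc[OF y Jy H, symmetric]
      by (simp add: comparison_tinj comparison_column_chain)
    also have "\<dots> = (?U \<cdot> comparison C D n) \<cdot> tinj (ctr C) (ctr D) i j"
      unfolding comparison_tinj[OF n, symmetric] by (rule arr_comp_assoc[OF Jn H U, symmetric])
    finally show "(comparison C D (Suc n) \<cdot> ?T n) \<cdot> tinj (ctr C) (ctr D) i j =
        (?U \<cdot> comparison C D n) \<cdot> tinj (ctr C) (ctr D) i j" .
  qed
  then show ?thesis by (simp add: cochain_tensor_def)
qed

text \<open>
  In degrees \<open>0\<close> and \<open>1\<close> the lists of summands of the two complexes coincide, so sending
  each summand to itself is the identity.
\<close>

lemma comparison_low:
  assumes "n \<le> 1"
  shows "comparison C D n = idm A (gr (cochain_tensor A S (ctr C) (ctr D)) n)"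
proof -
  have cdn: "cd n = n" using assms by (cases n) (auto simp: cdeg_def)
  have summands: "tensor_summands A (ctr C) (ctr D) n = tensor_summands A C D n"
    using assms by (cases n) (auto simp: tensor_summands_def contraction_simps cdeg_def)
  then have gr: "tgr (ctr C) (ctr D) n = tgr C D n" by (simp add: tensor_gr_def)
  have "comparison C D n = idm A (tgr C D n)"
  proof (rule tensor_ext[OF ctr_graded comparison_arr])
    show "arr (tgr (ctr C) (ctr D) n) (tgr C D (cd n)) (idm A (tgr C D n))"
      unfolding gr cdn by (rule id_arr[OF tensor_gr_ob[OF C D]])
    fix i j assume n: "i + j = n"
    then have ij: "even i \<or> even j" "cd i = i" "cd j = j"
      using assms by (cases i; cases j; auto simp: cdeg_def)+
    have "comparison C D n \<cdot> tinj (ctr C) (ctr D) i j = tinj C D i j"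
      using comparison_tinj[OF n] comparison_column_tinj[OF ij(1)] ij(2,3) by simp
    also have "\<dots> = idm A (tgr C D n) \<cdot> tinj C D i j"
      using arr_comp_id(2)[OF tinj_arr[OF C D]] n by metis
    also have "tinj C D i j = tinj (ctr C) (ctr D) i j"
      using summands n by (simp add: tinj_def)
    finally show "comparison C D n \<cdot> tinj (ctr C) (ctr D) i j = idm A (tgr C D n) \<cdot> tinj (ctr C) (ctr D) i j" .
  qed
  then show ?thesis by (simp add: cochain_tensor_def gr)
qed

lemma pCD_summands_length: "k < length (pCD_summands p A C D n) \<longleftrightarrow> even n \<and> 2 * k \<le> n"
  by (auto simp: pCD_summands_def)

lemma pCD_summands_ob: "set (pCD_summands p A C D n) \<subseteq> Ob A"
  by (auto simp: pCD_summands_def intro!: tobj_closed gr_ob C D)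

lemma pCD_dsum:
  "is_direct_sum A (pCD_summands p A C D n) (pCD_gr p A S C D n)
     (sinj S (pCD_summands p A C D n)) (sprj S (pCD_summands p A C D n))"
  using choice pCD_summands_ob by (simp add: direct_sum_choice_def pCD_gr_def)

lemma pCD_incl:
  assumes B: "graded_with_dif A B" and E: "graded_with_dif A E"
    and idx: "\<And>k. k < length (pCD_summands p A C D n) \<Longrightarrow>
      \<phi> k \<le> N \<and> tensor_summands A B E N ! \<phi> k = pCD_summands p A C D n ! k"
  defines "I \<equiv> summand_incl A S (pCD_summands p A C D n) (tensor_summands A B E N) \<phi>"
  shows "arr (pCD_gr p A S C D n) (tgr B E N) I"
    and "k < length (pCD_summands p A C D n) \<Longrightarrow>
      I \<cdot> sinj S (pCD_summands p A C D n) k = tinj B E (\<phi> k) (N - \<phi> k)"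
proof -
  have inj: "arr (pCD_summands p A C D n ! k) (tgr B E N) (sinj S (tensor_summands A B E N) (\<phi> k))"
    if "k < length (pCD_summands p A C D n)" for k
  proof -
    have "pCD_summands p A C D n ! k = summ B E (\<phi> k) (N - \<phi> k)"
      using idx[OF that] summands_nth[of "\<phi> k" N B E] by simp
    then show ?thesis
      using tinj_arr[OF B E, of "\<phi> k" "N - \<phi> k"] idx[OF that] by (simp add: tinj_def)
  qed
  note * = copair[OF pCD_dsum pCD_summands_ob, where \<phi> = "\<lambda>k. sinj S (tensor_summands A B E N) (\<phi> k)",
      OF tensor_gr_ob[OF B E] inj]
  show "arr (pCD_gr p A S C D n) (tgr B E N) I"
    using *(1) by (simp add: I_def summand_incl_def pCD_gr_def tensor_gr_def)
  show "I \<cdot> sinj S (pCD_summands p A C D n) k = tinj B E (\<phi> k) (N - \<phi> k)"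
    if "k < length (pCD_summands p A C D n)"
    using *(2)[OF _ that] that idx[OF that]
    by (simp add: I_def summand_incl_def pCD_gr_def tensor_gr_def tinj_def)
qed

text \<open>
  The summands of \<open>p(C,D)\<close> have indices \<open>(2 k, n - 2 k)\<close> in \<open>C\<^sub>[\<^sub>1\<^sub>] \<otimes> D\<^sub>[\<^sub>1\<^sub>]\<close> with \<open>n\<close> even, where the
  comparison is the inclusion.  For odd \<open>n\<close> there are no summands to check.
\<close>

lemma comparison_pCD:
  "comparison C D n \<cdot> pCD_incl_tensor p A S C D n =
    pCD_incl_contraction p A S C D n \<cdot> idm A (pCD_gr p A S C D n)"
proof -
  let ?Xs = "pCD_summands p A C D n"
  have i1: "2 * k \<le> n \<and> tensor_summands A (ctr C) (ctr D) n ! (2 * k) = ?Xs ! k"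
    and i2: "p * k \<le> cd n \<and> tensor_summands A C D (cd n) ! (p * k) = ?Xs ! k" if "k < length ?Xs" for k
    using that pCD_summands_nth[OF that] pCD_summands_length[of k n] by (auto simp: cdeg_def)
  note I1 = pCD_incl[OF ctr_graded i1] and I2 = pCD_incl[OF C D i2]
  have "comparison C D n \<cdot> pCD_incl_tensor p A S C D n = pCD_incl_contraction p A S C D n"
    unfolding pCD_incl_tensor_def pCD_incl_contraction_def One_nat_def
  proof (rule dsum_ext[OF pCD_dsum pCD_summands_ob comp_arr[OF I1(1) comparison_arr] I2(1)])
    fix k assume k: "k < length ?Xs"
    then obtain m where n: "n = 2 * m" and km: "k \<le> m"
      using pCD_summands_length by auto
    let ?I = "summand_incl A S ?Xs (tensor_summands A (ctr C) (ctr D) n) (\<lambda>k. 2 * k)"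
    have "(comparison C D n \<cdot> ?I) \<cdot> sinj S ?Xs k = comparison C D n \<cdot> (?I \<cdot> sinj S ?Xs k)"
      by (rule arr_comp_assoc[OF dsum_arr(1)[OF pCD_dsum pCD_summands_ob k] I1(1) comparison_arr])
    also have "?I \<cdot> sinj S ?Xs k = tinj (ctr C) (ctr D) (2 * k) (n - 2 * k)"
      by (rule I1(2)[OF _ k])
    also have "comparison C D n \<cdot> \<dots> = tinj C D (cd (2 * k)) (cd (n - 2 * k))"
      using km n by (simp add: comparison_tinj comparison_column_tinj)
    also have "\<dots> = tinj C D (p * k) (cd n - p * k)"
      using km n by (simp add: cdeg_def diff_mult_distrib2 flip: diff_mult_distrib2)
    also have "\<dots> = summand_incl A S ?Xs (tensor_summands A C D (cd n)) (\<lambda>k. p * k) \<cdot> sinj S ?Xs k"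
      by (rule I2(2)[OF _ k, symmetric])
    finally show "(comparison C D n \<cdot> ?I) \<cdot> sinj S ?Xs k =
        summand_incl A S ?Xs (tensor_summands A C D (cd n)) (\<lambda>k. p * k) \<cdot> sinj S ?Xs k" .
  qed
  moreover have "pCD_incl_contraction p A S C D n \<cdot> idm A (pCD_gr p A S C D n) = pCD_incl_contraction p A S C D n"
    unfolding pCD_incl_contraction_def One_nat_def by (rule arr_comp_id(1)[OF I2(1)])
  ultimately show ?thesis by simp
qed

end

lemma comparison_cochain_morphism:
  assumes C: "p_complex p A C" and D: "p_complex p A D"
  shows "cochain_morphism A (cochain_tensor A S (ctr C) (ctr D)) (ctr (p_tensor A S C D)) (comparison C D)"
proof -
  note gC = p_complex_graded[OF C] and gD = p_complex_graded[OF D]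
  have "cochain_complex A (cochain_tensor A S (ctr C) (ctr D))"
    by (intro cochain_tensor_cochain ctr_graded[OF gC gD] contraction_cochain C D one_le_p)
  moreover have "cochain_complex A (ctr (p_tensor A S C D))"
    by (intro contraction_cochain p_tensor_p_complex[OF gC gD] C D one_le_p)
  moreover have "dif_morphism A (cochain_tensor A S (ctr C) (ctr D)) (ctr (p_tensor A S C D)) (comparison C D)"
    unfolding dif_morphism_def comparison_chain[OF gC gD] contraction_simps(1)
    using arr_hom[OF comparison_arr[OF gC gD]] by (simp add: cochain_tensor_def p_tensor_def)
  ultimately show ?thesis by (simp add: cochain_morphism_def)
qed

lemma comparison_natural:
  assumes f: "p_complex_morphism p A C C' f" and g: "p_complex_morphism p A D D' g"
  shows "comparison C' D' n \<cdot> tensor_mor A S (ctr C) (ctr D) (ctr C') (ctr D')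
      (contraction_mor p (Suc 0) f) (contraction_mor p (Suc 0) g) n =
    contraction_mor p (Suc 0) (tensor_mor A S C D C' D' f g) n \<cdot> comparison C D n"
proof -
  have gr: "graded_with_dif A C" "graded_with_dif A D" "graded_with_dif A C'" "graded_with_dif A D'"
    and dm: "dif_morphism A C C' f" "dif_morphism A D D' g"
    using f g p_complex_graded by (auto simp: p_complex_morphism_def)
  have fa: "arr (gr C i) (gr C' i) (f i)" and ga: "arr (gr D i) (gr D' i) (g i)" for i
    using dm gr_ob gr by (auto simp: dif_morphism_def arr_def)
  let ?f = "contraction_mor p (Suc 0) f" and ?g = "contraction_mor p (Suc 0) g"
  let ?F = "tensor_mor A S (ctr C) (ctr D) (ctr C') (ctr D') ?f ?g n"
    and ?G = "tensor_mor A S C D C' D' f g (cd n)"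
  note cg = ctr_graded[OF gr(1,2)] and cg' = ctr_graded[OF gr(3,4)]
  have fc: "arr (gr (ctr C) i) (gr (ctr C') i) (?f i)" and gc: "arr (gr (ctr D) i) (gr (ctr D') i) (?g i)" for i
    by (simp_all add: contraction_mor_def contraction_simps fa ga)
  note F = tensor_mor_arr[OF cg cg' fc gc, of n] and G = tensor_mor_arr[OF gr fa ga, of "cd n"]
  note H = comparison_arr[OF gr(1,2), of n] and H' = comparison_arr[OF gr(3,4), of n]
  have "comparison C' D' n \<cdot> ?F = ?G \<cdot> comparison C D n"
  proof (rule tensor_ext[OF cg comp_arr[OF F H'] comp_arr[OF H G]])
    fix i j assume n: "i + j = n"
    have J: "arr (summ (ctr C) (ctr D) i j) (tgr (ctr C) (ctr D) n) (tinj (ctr C) (ctr D) i j)"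
      and J': "arr (summ (ctr C') (ctr D') i j) (tgr (ctr C') (ctr D') n) (tinj (ctr C') (ctr D') i j)"
      using tinj_arr[OF cg, of i j] tinj_arr[OF cg', of i j] n by simp_all
    have "(comparison C' D' n \<cdot> ?F) \<cdot> tinj (ctr C) (ctr D) i j =
        comparison C' D' n \<cdot> (?F \<cdot> tinj (ctr C) (ctr D) i j)"
      by (rule arr_comp_assoc[OF J F H'])
    also have "?F \<cdot> tinj (ctr C) (ctr D) i j = tinj (ctr C') (ctr D') i j \<cdot> (?f i \<boxtimes>m ?g j)"
      by (rule tensor_mor_tinj[OF cg cg' fc gc n])
    also have "comparison C' D' n \<cdot> \<dots> = (comparison C' D' n \<cdot> tinj (ctr C') (ctr D') i j) \<cdot> (?f i \<boxtimes>m ?g j)"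
      by (rule arr_comp_assoc[OF tens_arr[OF fc gc] J' H', symmetric])
    also have "\<dots> = comparison_column C' D' i j \<cdot> (f (cd i) \<boxtimes>m g (cd j))"
      unfolding comparison_tinj[OF gr(3,4) n] by (simp add: contraction_mor_def)
    also have "\<dots> = ?G \<cdot> comparison_column C D i j"
      unfolding comparison_column_def
      by (rule tensor_mor_tpoly[OF gr dm, symmetric]) (simp add: cdeg_gap n)
    also have "\<dots> = (?G \<cdot> comparison C D n) \<cdot> tinj (ctr C) (ctr D) i j"
      unfolding comparison_tinj[OF gr(1,2) n, symmetric] by (rule arr_comp_assoc[OF J H G, symmetric])
    finally show "(comparison C' D' n \<cdot> ?F) \<cdot> tinj (ctr C) (ctr D) i j =
        (?G \<cdot> comparison C D n) \<cdot> tinj (ctr C) (ctr D) i j" .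
  qed
  then show ?thesis by (simp add: contraction_mor_def)
qed

end

theorem proposition2p4:
  fixes p :: nat and A :: "('o, 'm) mon_cat" and S :: "('o, 'm) sum_choice"
  assumes "prime p"
    and "fp_biexact_monoidal_category p A"
    and "direct_sum_choice A S"
  shows "\<exists>h :: ('o, 'm) cpx \<Rightarrow> ('o, 'm) cpx \<Rightarrow> nat \<Rightarrow> 'm.
    (\<forall>C D. p_complex p A C \<longrightarrow> p_complex p A D \<longrightarrow>
      (let T = cochain_tensor A S (contraction p A 1 C) (contraction p A 1 D);
           U = contraction p A 1 (p_tensor A S C D)
       in cochain_morphism A T U (h C D) \<and>
          h C D 0 = idm A (gr T 0) \<and> h C D 1 = idm A (gr T 1) \<and>
          (\<forall>n. Comp A (h C D n) (pCD_incl_tensor p A S C D n) =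
               Comp A (pCD_incl_contraction p A S C D n) (idm A (pCD_gr p A S C D n))))) \<and>
    (\<forall>C D C' D' f g. p_complex_morphism p A C C' f \<longrightarrow> p_complex_morphism p A D D' g \<longrightarrow>
      (\<forall>n. Comp A (h C' D' n)
             (tensor_mor A S (contraction p A 1 C) (contraction p A 1 D)
               (contraction p A 1 C') (contraction p A 1 D')
               (contraction_mor p 1 f) (contraction_mor p 1 g) n) =
           Comp A (contraction_mor p 1 (tensor_mor A S C D C' D' f g) n) (h C D n)))"
proof -
  interpret fp_biexact_monoidal_category p A by fact
  interpret tensor_setting p A S
    by unfold_locales (fact assms)+
  show ?thesis
    unfolding Let_def One_nat_def
    by (intro exI[of _ comparison] conjI allI impI comparison_cochain_morphism comparison_natural
        comparison_low[unfolded One_nat_def] comparison_pCD p_complex_graded; simp?)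
qed

end
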